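(* Let $\mathcal P\subset\mathbb R^p$ be compact and, for each $\mu\in\mathcal P$, let $X_\mu,Y_\mu$ be Banach spaces of $\mathbb R^m$-valued functions on a bounded domain $\Omega\subseteq\mathbb R^d$, with (possibly $\mu$-dependent) norms $\|\cdot\|_{X_\mu},\|\cdot\|_{Y_\mu}$. Let $b_\mu:X_\mu\times Y_\mu\to\mathbb R$ be bilinear and $f_\mu:Y_\mu\to\mathbb R$ linear such that for each $\mu\in\mathcal P$ the problem $$\text{find } u_\mu\in X_\mu:\quad b_\mu(u_\mu,v)=f_\mu(v)\quad\text{for all } v\in Y_\mu$$ is well-posed. Let $\sigma_{\mathrm{sol}}$ be the solution section $\mu\mapsto u_\mu\in X_\mu$, and set $X_0:=\bigcap_{\mu\in\mathcal P}X_\mu$, $Y_0:=\bigcap_{\mu\in\mathcal P}Y_\mu$. Assume: 1. $X_0$ is dense in $X_\mu$ and $Y_0$ is dense in $Y_\mu$ for every $\mu\in\mathcal P$. 2. There are parameter-independent norms $\|\cdot\|_{X_0}$ on $X_0$ and $\|\cdot\|_{Y_0}$ on $Y_0$ and $\mu$-independent constants $c,\tilde c,C,\tilde C>0$ such that for all $\mu\in\mathcal P$ $$\tilde c\|u\|_{X_0}\le\|u\|_{X_\mu}\le\tilde C\|u\|_{X_0}\quad\text{for all } u\in X_0,\qquad c\|v\|_{Y_0}\le\|v\|_{Y_\mu}\le C\|v\|_{Y_0}\quad\text{for all } v\in Y_0.$$ 3. $b_\mu$ and $f_\mu$ are parameter-separable on $X_0,Y_0$: there exist continuous functions $\theta^b_i:\mathcal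 P\to\mathbb R$ ($1\le i\le Q_b$), $\theta^f_i:\mathcal P\to\mathbb R$ ($1\le i\le Q_f$), continuous bilinear forms $b_i:X_0\times Y_0\to\mathbb R$ and continuous linear functionals $f_i:Y_0\to\mathbb R$ such that for all $\mu\in\mathcal P$, $u\in X_0$, $v\in Y_0$ $$b_\mu(u,v)=\sum_{i=1}^{Q_b}\theta^b_i(\mu)\,b_i(u,v),\qquad f_\mu(v)=\sum_{i=1}^{Q_f}\theta^f_i(\mu)\,f_i(v).$$ Then the Sectional Kolmogorov $N$-width of $\sigma_{\mathrm{sol}}$ with respect to the space $\Gamma_{X_0}$ of constant sections with values in $X_0$ decays exponentially: there are constants $\alpha,\beta>0$ independent of $N$ such that for all $N\ge 1$ $$d_N(\sigma_{\mathrm{sol}};\Gamma_{X_0})\le\alpha\exp\!\big(-\beta N^{1/Q_b}\big).$$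
   Context: Well-posed is understood in the usual Banach–Nečas–Babuška sense: for each fixed $\mu$, $b_\mu$ is continuous on $X_\mu\times Y_\mu$, $f_\mu\in Y_\mu'$, and for every functional in $Y_\mu'$ as right-hand side there is a unique solution in $X_\mu$, depending continuously on it. A section is a map $\sigma$ on $\mathcal P$ with $\sigma(\mu)\in X_\mu$ for each $\mu$ (no continuity required here); sections form a vector space under pointwise operations. For a vector space $\Gamma$ of sections, the Sectional Kolmogorov $N$-width of a section $\sigma$ is $$d_N(\sigma;\Gamma):=\inf_{\substack{\Gamma_N\subset\Gamma\text{ linear subspace}\\ \dim\Gamma_N\le N}}\ \sup_{\mu\in\mathcal P}\ \inf_{\sigma_N\in\Gamma_N}\|\sigma(\mu)-\sigma_N(\mu)\|_{X_\mu}.$$ For $\varphi\in X_0$ the constant section is $\sigma_\varphi(\mu):=\varphi$ for all $\mu$, and $\Gamma_{X_0}:=\{\sigma_\varphi:\varphi\in X_0\}$. Continuity of $b_i,f_i$ is with respect to $\|\cdot\|_{X_0},\|\cdot\|_{Y_0}$. *)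

theory Defs
  imports "HOL-Analysis.Analysis" "HOL-Library.Function_Algebras"
begin

text \<open>Pointwise scalar multiplication makes both the functions on the physical domain and the
  sections real vector spaces, so that \<^const>\<open>subspace\<close> and \<^const>\<open>span\<close> apply to them.\<close>

instantiation "fun" :: (type, real_vector) real_vector
begin

definition scaleR_fun_def: "r *\<^sub>R f = (\<lambda>x. r *\<^sub>R f x)"

instance
  by standard (auto simp: scaleR_fun_def fun_eq_iff scaleR_add_right scaleR_add_left)

end

text \<open>Functions on a domain are represented by total functions, and two of them are the same
  element of a function space iff their difference lies in \<^term>\<open>null_funs M\<close>. For
  \<^term>\<open>M = count_space \<Omega>\<close> this means equality at every point of \<^term>\<open>\<Omega>\<close>; for
  \<^term>\<open>M = lebesgue_on \<Omega>\<close> it means equality almost everywhere on \<^term>\<open>\<Omega>\<close>.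
  A space \<^term>\<open>V\<close> of (classes of) functions is the set of all representatives of its elements, and
  a norm on it vanishes exactly on the representatives of zero. Below, \<^term>\<open>Z\<close> is this set of
  representatives of zero.\<close>

definition null_funs :: "'a measure \<Rightarrow> ('a \<Rightarrow> 'b::real_vector) set" where
  "null_funs M = {u. AE x in M. u x = 0}"

definition normed_space_on :: "'v::real_vector set \<Rightarrow> 'v set \<Rightarrow> ('v \<Rightarrow> real) \<Rightarrow> bool" where
  "normed_space_on Z V n \<longleftrightarrow>
     subspace V \<and> Z \<subseteq> V \<and>
     (\<forall>u\<in>V. 0 \<le> n u) \<and>
     (\<forall>u\<in>V. n u = 0 \<longleftrightarrow> u \<in> Z) \<and>
     (\<forall>r. \<forall>u\<in>V. n (r *\<^sub>R u) = \<bar>r\<bar> * n u) \<and>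
     (\<forall>u\<in>V. \<forall>w\<in>V. n (u + w) \<le> n u + n w)"

definition banach_space_on :: "'v::real_vector set \<Rightarrow> 'v set \<Rightarrow> ('v \<Rightarrow> real) \<Rightarrow> bool" where
  "banach_space_on Z V n \<longleftrightarrow>
     normed_space_on Z V n \<and>
     (\<forall>s::nat \<Rightarrow> 'v.
        (\<forall>k. s k \<in> V) \<and> (\<forall>\<epsilon>>0. \<exists>K. \<forall>i\<ge>K. \<forall>j\<ge>K. n (s i - s j) < \<epsilon>) \<longrightarrow>
        (\<exists>l\<in>V. (\<lambda>k. n (s k - l)) \<longlonglongrightarrow> 0))"

definition dense_in_norm :: "'v::real_vector set \<Rightarrow> 'v set \<Rightarrow> ('v \<Rightarrow> real) \<Rightarrow> bool" where
  "dense_in_norm V0 V n \<longleftrightarrow> V0 \<subseteq> V \<and> (\<forall>u\<in>V. \<forall>\<epsilon>>0. \<exists>w\<in>V0. n (u - w) < \<epsilon>)"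

definition linear_form_on :: "'v::real_vector set \<Rightarrow> ('v \<Rightarrow> real) \<Rightarrow> bool" where
  "linear_form_on V g \<longleftrightarrow>
     (\<forall>u\<in>V. \<forall>w\<in>V. g (u + w) = g u + g w) \<and> (\<forall>r. \<forall>u\<in>V. g (r *\<^sub>R u) = r * g u)"

definition bilinear_form_on ::
    "'v::real_vector set \<Rightarrow> 'w::real_vector set \<Rightarrow> ('v \<Rightarrow> 'w \<Rightarrow> real) \<Rightarrow> bool" where
  "bilinear_form_on V W a \<longleftrightarrow>
     (\<forall>w\<in>W. linear_form_on V (\<lambda>u. a u w)) \<and> (\<forall>u\<in>V. linear_form_on W (a u))"

definition dual_space :: "'v::real_vector set \<Rightarrow> ('v \<Rightarrow> real) \<Rightarrow> ('v \<Rightarrow> real) set" where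
  "dual_space V n = {g. linear_form_on V g \<and> (\<exists>K. \<forall>u\<in>V. \<bar>g u\<bar> \<le> K * n u)}"

definition dual_norm :: "'v::real_vector set \<Rightarrow> ('v \<Rightarrow> real) \<Rightarrow> ('v \<Rightarrow> real) \<Rightarrow> real" where
  "dual_norm V n g = (SUP u\<in>{u\<in>V. n u \<le> 1}. \<bar>g u\<bar>)"

definition continuous_bilinear_form_on ::
    "'v::real_vector set \<Rightarrow> ('v \<Rightarrow> real) \<Rightarrow> 'w::real_vector set \<Rightarrow> ('w \<Rightarrow> real) \<Rightarrow>
     ('v \<Rightarrow> 'w \<Rightarrow> real) \<Rightarrow> bool" where
  "continuous_bilinear_form_on V nV W nW a \<longleftrightarrow>
     bilinear_form_on V W a \<and> (\<exists>K. \<forall>u\<in>V. \<forall>w\<in>W. \<bar>a u w\<bar> \<le> K * nV u * nW w)"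

definition solves :: "'v set \<Rightarrow> 'w set \<Rightarrow> ('v \<Rightarrow> 'w \<Rightarrow> real) \<Rightarrow> ('w \<Rightarrow> real) \<Rightarrow> 'v \<Rightarrow> bool" where
  "solves X Y b g u \<longleftrightarrow> u \<in> X \<and> (\<forall>v\<in>Y. b u v = g v)"

text \<open>The solution operator is linear, so its continuity is expressed by a stability
  estimate.\<close>

definition well_posed ::
    "'v::real_vector set \<Rightarrow> 'v set \<Rightarrow> ('v \<Rightarrow> real) \<Rightarrow> 'w::real_vector set \<Rightarrow> ('w \<Rightarrow> real) \<Rightarrow>
     ('v \<Rightarrow> 'w \<Rightarrow> real) \<Rightarrow> ('w \<Rightarrow> real) \<Rightarrow> bool" where
  "well_posed Z X nX Y nY b f \<longleftrightarrow>
     continuous_bilinear_form_on X nX Y nY b \<and>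
     f \<in> dual_space Y nY \<and>
     (\<forall>g\<in>dual_space Y nY.
        (\<exists>u. solves X Y b g u) \<and>
        (\<forall>u u'. solves X Y b g u \<and> solves X Y b g u' \<longrightarrow> u - u' \<in> Z)) \<and>
     (\<exists>K. \<forall>g\<in>dual_space Y nY. \<forall>u. solves X Y b g u \<longrightarrow> nX u \<le> K * dual_norm Y nY g)"

text \<open>The dimension bound is phrased with spanning sets because \<^const>\<open>dim\<close> is \<open>0\<close> on
  infinite-dimensional subspaces.\<close>

definition dim_at_most :: "'v::real_vector set \<Rightarrow> nat \<Rightarrow> bool" where
  "dim_at_most V N \<longleftrightarrow> (\<exists>B. finite B \<and> card B \<le> N \<and> span B = V)"

definition const_sections :: "'v set \<Rightarrow> ('p \<Rightarrow> 'v) set" where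
  "const_sections V = {\<lambda>\<mu>. \<phi> |\<phi>. \<phi> \<in> V}"

text \<open>The width takes values in the extended nonnegative reals because the supremum may be
  infinite. Passing from classes of functions to representatives does not change it: a
  subspace of classes of dimension at most \<open>N\<close> lifts to one of representatives, and conversely.\<close>

definition sectional_width ::
    "'p set \<Rightarrow> ('p \<Rightarrow> 'v \<Rightarrow> real) \<Rightarrow> ('p \<Rightarrow> 'v::real_vector) set \<Rightarrow> nat \<Rightarrow> ('p \<Rightarrow> 'v) \<Rightarrow> ennreal" where
  "sectional_width P nX \<Gamma> N \<sigma> =
     (INF \<Gamma>N\<in>{S. S \<subseteq> \<Gamma> \<and> subspace S \<and> dim_at_most S N}.
        SUP \<mu>\<in>P. INF \<tau>\<in>\<Gamma>N. ennreal (nX \<mu> (\<sigma> \<mu> - \<tau> \<mu>)))"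

end

(*
  In the equivalent norms of X0 and Y0, the map theta |-> (sum_i theta_i b_i)^{-1} is analytic, so the
  Neumann series of u_mu around a parameter mu0 is a power series in the Q_b numbers
  theta_i(mu) - theta_i(mu0).  Its truncation at total degree m has at most m^{Q_b} coefficients and an
  error of order 2^{-m} near mu0, and by compactness finitely many centres mu0 suffice.  The exact
  Taylor coefficients need not lie in X0, whose elements alone are admissible, so each step of their
  recursion is solved in X0 only up to a tolerance 4^{-m}.
*)

theory Submission
  imports Defs "HOL-Real_Asymp.Real_Asymp"
begin

text \<open>Solutions for different \<mu> may lie in different spaces, so they are never subtracted
  from each other. All comparisons go through residuals on \<open>X0\<close> and \<open>Y0\<close>;
  stability turns a residual into an error in \<open>X \<mu>\<close> only at the end.
  \<open>X0\<close> need not be complete, so b_\<mu> need not be invertible from \<open>X0\<close>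
  onto the dual of \<open>Y0\<close>. What survives of the inverse is a stability estimate and
  solvability up to any tolerance, and the expansion rests on these two. Each f_i is expanded
  separately as a fixed right-hand side, and the factors \<open>\<theta>f i \<mu>\<close> return as
  weights of the approximants. Thus Q_f multiplies the dimension and does not enter the exponent. If
  the coefficients grow at most by a factor L per degree, the neighbourhood of a centre is given by
  |\<theta>_i(\<mu>) - \<theta>_i(\<mu>0)| \<le> 1/(4 L). Degree m then costs 4^-m per coefficient,
  like the tolerance, and the passage from 4^-m to 2^-m pays for the polynomial number of
  coefficients. Well-posedness gives a stability constant for each \<mu> without uniformity. Near a
  centre twice the constant of the centre serves, so only finitely many constants matter.\<close>

section \<open>Norms on subspaces and functionals on a dense subspace\<close>

lemma
  assumes "normed_space_on Z V n"
  shows normed_space_on_subspace: "subspace V"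
    and normed_space_on_nonneg: "u \<in> V \<Longrightarrow> 0 \<le> n u"
    and normed_space_on_scale: "u \<in> V \<Longrightarrow> n (r *\<^sub>R u) = \<bar>r\<bar> * n u"
    and normed_space_on_triangle: "u \<in> V \<Longrightarrow> w \<in> V \<Longrightarrow> n (u + w) \<le> n u + n w"
  using assms by (simp_all add: normed_space_on_def)

lemma normed_space_on_zero:
  assumes "normed_space_on Z V n"
  shows "n 0 = 0"
  using normed_space_on_scale[OF assms, of 0 0] subspace_0[OF normed_space_on_subspace[OF assms]]
  by simp

lemma normed_space_on_minus_commute:
  assumes "normed_space_on Z V n" "u \<in> V" "w \<in> V"
  shows "n (u - w) = n (w - u)"
proof -
  have "u - w \<in> V"
    using assms normed_space_on_subspace subspace_diff by blast
  from normed_space_on_scale[OF assms(1) this, of "-1"] show ?thesis by simp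
qed

lemma normed_space_on_triangle_diff:
  assumes "normed_space_on Z V n" "u \<in> V" "w \<in> V" "x \<in> V"
  shows "n (u - x) \<le> n (u - w) + n (w - x)"
proof -
  have "u - w \<in> V" "w - x \<in> V"
    using assms normed_space_on_subspace subspace_diff by blast+
  from normed_space_on_triangle[OF assms(1) this] show ?thesis by simp
qed

lemma normed_space_on_sum:
  assumes V: "normed_space_on Z V n" and "finite S" "\<And>i. i \<in> S \<Longrightarrow> u i \<in> V"
  shows "n (\<Sum>i\<in>S. u i) \<le> (\<Sum>i\<in>S. n (u i))"
  using assms(2,3)
proof (induction S rule: finite_induct)
  case empty
  then show ?case using normed_space_on_zero[OF V] by simp
next
  case (insert i S)
  have "n (u i + (\<Sum>i\<in>S. u i)) \<le> n (u i) + n (\<Sum>i\<in>S. u i)"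
    using insert.prems
    by (intro normed_space_on_triangle[OF V] subspace_sum[OF normed_space_on_subspace[OF V]]) auto
  then show ?case using insert by auto
qed

lemma
  assumes "linear_form_on V g"
  shows linear_form_on_add: "u \<in> V \<Longrightarrow> w \<in> V \<Longrightarrow> g (u + w) = g u + g w"
    and linear_form_on_scale: "u \<in> V \<Longrightarrow> g (r *\<^sub>R u) = r * g u"
  using assms by (simp_all add: linear_form_on_def)

lemma linear_form_on_zero:
  assumes "linear_form_on V g" "subspace V"
  shows "g 0 = 0"
  using linear_form_on_scale[OF assms(1), of 0 0] subspace_0[OF assms(2)] by simp

lemma linear_form_on_diff:
  assumes "linear_form_on V g" "subspace V" "u \<in> V" "w \<in> V"
  shows "g (u - w) = g u - g w"
  using linear_form_on_add[OF assms(1) subspace_diff[OF assms(2-4)] assms(4)] by simp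

lemma linear_form_on_sum:
  assumes g: "linear_form_on V g" and V: "subspace V"
    and "finite S" "\<And>i. i \<in> S \<Longrightarrow> u i \<in> V"
  shows "g (\<Sum>i\<in>S. r i *\<^sub>R u i) = (\<Sum>i\<in>S. r i * g (u i))"
  using assms(3,4)
proof (induction S rule: finite_induct)
  case empty
  then show ?case using linear_form_on_zero[OF g V] by simp
next
  case (insert i S)
  have "g (r i *\<^sub>R u i + (\<Sum>i\<in>S. r i *\<^sub>R u i)) = g (r i *\<^sub>R u i) + g (\<Sum>i\<in>S. r i *\<^sub>R u i)"
    using insert.prems
    by (intro linear_form_on_add[OF g] subspace_sum[OF V] subspace_scale[OF V]) auto
  also have "g (r i *\<^sub>R u i) = r i * g (u i)"
    using insert.prems by (intro linear_form_on_scale[OF g]) auto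
  finally show ?case using insert by simp
qed

lemma
  assumes "bilinear_form_on V W a"
  shows bilinear_form_on_left: "v \<in> W \<Longrightarrow> linear_form_on V (\<lambda>u. a u v)"
    and bilinear_form_on_right: "u \<in> V \<Longrightarrow> linear_form_on W (a u)"
  using assms by (simp_all add: bilinear_form_on_def)

lemma linear_form_on_sum_mult:
  assumes "\<And>i. i \<in> S \<Longrightarrow> linear_form_on V (g i)"
  shows "linear_form_on V (\<lambda>v. \<Sum>i\<in>S. r i * g i v)"
  unfolding linear_form_on_def
  by (auto simp: linear_form_on_add[OF assms] linear_form_on_scale[OF assms] algebra_simps
      sum.distrib sum_distrib_left)

text \<open>The extension at \<open>v\<close> is the only number within \<open>r * n (v - w)\<close> of \<open>g w\<close> for every \<open>w\<close> in the
  dense subspace.\<close>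

lemma extend_dense_functional:
  assumes V: "normed_space_on Z V n" and dense: "dense_in_norm V0 V n" and V0: "subspace V0"
    and g: "linear_form_on V0 g" and r: "0 \<le> r"
    and bound: "\<And>v. v \<in> V0 \<Longrightarrow> \<bar>g v\<bar> \<le> r * n v"
  obtains h where "linear_form_on V h" "\<And>v. v \<in> V0 \<Longrightarrow> h v = g v"
    "\<And>v. v \<in> V \<Longrightarrow> \<bar>h v\<bar> \<le> r * n v"
proof -
  have sub: "V0 \<subseteq> V" using dense by (simp add: dense_in_norm_def)
  have approx: "\<exists>w\<in>V0. n (v - w) < e" if "v \<in> V" "0 < e" for v e
    using dense that by (simp add: dense_in_norm_def)
  note VS = normed_space_on_subspace[OF V]
  \<comment> \<open>This is the McShane extension of \<open>g\<close>, which is Lipschitz with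
    constant \<open>r\<close>. It needs no sequences and no completeness; its linearity comes from
    density.\<close>
  define h where "h v = (SUP w\<in>V0. g w - r * n (v - w))" for v
  have close: "\<bar>h v - g w\<bar> \<le> r * n (v - w)" if v: "v \<in> V" and w: "w \<in> V0" for v w
  proof -
    have le: "g x - r * n (v - x) \<le> g y + r * n (v - y)" if "x \<in> V0" "y \<in> V0" for x y
    proof -
      have "g x - g y \<le> r * n (x - y)"
        using bound[OF subspace_diff[OF V0 that]] linear_form_on_diff[OF g V0 that] by simp
      also have "\<dots> \<le> r * (n (v - x) + n (v - y))"
        using normed_space_on_triangle_diff[OF V, of x v y]
          normed_space_on_minus_commute[OF V, of x v] that sub v r
        by (intro mult_left_mono) auto
      finally show ?thesis by (simp add: algebra_simps)
    qed
    have "h v \<le> g w + r * n (v - w)"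
      unfolding h_def using le w by (intro cSUP_least) auto
    moreover have "g w - r * n (v - w) \<le> h v"
      unfolding h_def using le[OF _ w] w by (intro cSUP_upper bdd_aboveI2)
    ultimately show ?thesis by linarith
  qed
  \<comment> \<open>To identify \<open>h v\<close>, one suitable \<open>w\<close> at each scale
    \<open>e\<close> is enough, with an error up to a fixed multiple of \<open>e\<close>. Additivity
    and homogeneity both reduce to this.\<close>
  have unique: "h v = x"
    if v: "v \<in> V" and x: "\<And>e. 0 < e \<Longrightarrow> \<exists>w\<in>V0. n (v - w) < e \<and> \<bar>x - g w\<bar> \<le> s * e" and s: "0 \<le> s" for v x s
  proof -
    have "\<bar>h v - x\<bar> \<le> 0 + e" if e: "0 < e" for e
    proof -
      let ?d = "e / (r + s + 1)"
      have d: "0 < ?d" using e r s by simp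
      obtain w where w: "w \<in> V0" "n (v - w) < ?d" "\<bar>x - g w\<bar> \<le> s * ?d" using x[OF d] by blast
      have "\<bar>h v - g w\<bar> \<le> r * ?d"
        using close[OF v w(1)] mult_left_mono[OF less_imp_le[OF w(2)] r] by linarith
      then have "\<bar>h v - x\<bar> \<le> (r + s) * ?d" using w(3) by (simp only: distrib_right)
      also have "\<dots> \<le> (r + s + 1) * ?d" using d by (intro mult_right_mono) auto
      also have "\<dots> = e" using r s by simp
      finally show ?thesis by simp
    qed
    then have "\<bar>h v - x\<bar> \<le> 0" by (rule field_le_epsilon)
    then show ?thesis by simp
  qed
  have "h (u + v) = h u + h v" if u: "u \<in> V" and v: "v \<in> V" for u v
  proof (rule unique[where s = r])
    show "u + v \<in> V" using u v VS subspace_add by blast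
    fix e :: real assume e: "0 < e"
    obtain x y where xy: "x \<in> V0" "n (u - x) < e / 2" "y \<in> V0" "n (v - y) < e / 2"
      using approx[OF u, of "e / 2"] approx[OF v, of "e / 2"] e by auto
    have "n (u + v - (x + y)) \<le> n (u - x) + n (v - y)"
      using normed_space_on_triangle[OF V, of "u - x" "v - y"] subspace_diff[OF VS] xy sub u v
      by (auto simp: algebra_simps)
    moreover have "\<bar>h u - g x\<bar> \<le> r * (e / 2)" "\<bar>h v - g y\<bar> \<le> r * (e / 2)"
      using close[OF u xy(1)] close[OF v xy(3)] xy(2,4) r
      by (meson less_imp_le mult_left_mono order_trans)+
    then have "\<bar>h u + h v - g (x + y)\<bar> \<le> r * e"
      unfolding linear_form_on_add[OF g xy(1,3)] by (simp only: abs_le_iff) argo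
    ultimately show "\<exists>w\<in>V0. n (u + v - w) < e \<and> \<bar>h u + h v - g w\<bar> \<le> r * e"
      using xy subspace_add[OF V0 xy(1,3)] by (intro bexI[of _ "x + y"]) auto
  qed (rule r)
  moreover have "h (t *\<^sub>R v) = t * h v" if v: "v \<in> V" for t v
  proof (rule unique[where s = r])
    show "t *\<^sub>R v \<in> V" using v VS subspace_scale by blast
    fix e :: real assume e: "0 < e"
    let ?d = "e / (\<bar>t\<bar> + 1)"
    have d: "0 < ?d" using e by simp
    have te: "\<bar>t\<bar> * ?d \<le> e" using e by (simp add: field_simps)
    have te': "\<bar>t\<bar> * ?d < e" using e by (simp add: field_simps)
    obtain x where x: "x \<in> V0" "n (v - x) < ?d" using approx[OF v d] by blast
    have "n (t *\<^sub>R v - t *\<^sub>R x) = \<bar>t\<bar> * n (v - x)"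
      using normed_space_on_scale[OF V, of "v - x" t] subspace_diff[OF VS v] x(1) sub
      by (auto simp: scaleR_diff_right)
    also have "\<dots> \<le> \<bar>t\<bar> * ?d" using x(2) by (intro mult_left_mono) auto
    finally have 1: "n (t *\<^sub>R v - t *\<^sub>R x) < e" using te' by linarith
    have "\<bar>t * h v - g (t *\<^sub>R x)\<bar> = \<bar>t\<bar> * \<bar>h v - g x\<bar>"
      using linear_form_on_scale[OF g x(1)] by (simp add: abs_mult[symmetric] right_diff_distrib)
    also have "\<dots> \<le> \<bar>t\<bar> * (r * ?d)"
      using close[OF v x(1)] mult_left_mono[OF less_imp_le[OF x(2)] r] by (intro mult_left_mono) auto
    also have "\<dots> \<le> r * e" using mult_left_mono[OF te r] by (simp add: mult_ac)
    finally show "\<exists>w\<in>V0. n (t *\<^sub>R v - w) < e \<and> \<bar>t * h v - g w\<bar> \<le> r * e"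
      using 1 subspace_scale[OF V0 x(1)] by blast
  qed (rule r)
  ultimately have "linear_form_on V h" by (simp add: linear_form_on_def)
  moreover have "h v = g v" if "v \<in> V0" for v
    using close[of v v] that sub normed_space_on_zero[OF V] by auto
  moreover have "\<bar>h v\<bar> \<le> r * n v" if "v \<in> V" for v
    using close[OF that subspace_0[OF V0]] linear_form_on_zero[OF g V0] by simp
  ultimately show thesis by (rule that)
qed

text \<open>The constant \<open>k\<close> multiplies only the distance from \<open>v\<close> to the
  dense subspace, which can be made arbitrarily small, so the constant \<open>r\<close> survives
  unchanged. In use, \<open>r\<close> is a bound tested on \<open>Y0\<close> alone, and
  \<open>k\<close> comes from the continuity of the bilinear form.\<close>

lemma dense_functional_bound:
  assumes V: "normed_space_on Z V n" and dense: "dense_in_norm V0 V n"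
    and g: "linear_form_on V g" and r: "0 \<le> r"
    and cont: "\<And>v. v \<in> V \<Longrightarrow> \<bar>g v\<bar> \<le> k * n v"
    and bound: "\<And>v. v \<in> V0 \<Longrightarrow> \<bar>g v\<bar> \<le> r * n v"
    and v: "v \<in> V"
  shows "\<bar>g v\<bar> \<le> r * n v"
proof (rule field_le_epsilon)
  fix e :: real assume e: "0 < e"
  note VS = normed_space_on_subspace[OF V]
  let ?d = "e / (\<bar>k\<bar> + r + 1)"
  have d: "0 < ?d" using e r by simp
  obtain w where w: "w \<in> V0" "n (v - w) < ?d"
    using dense v d unfolding dense_in_norm_def by blast
  have wV: "w \<in> V" using w(1) dense by (auto simp: dense_in_norm_def)
  have nn: "0 \<le> n (v - w)" using normed_space_on_nonneg[OF V subspace_diff[OF VS v wV]] .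
  have "\<bar>g v\<bar> \<le> \<bar>g (v - w)\<bar> + \<bar>g w\<bar>" using linear_form_on_diff[OF g VS v wV] by linarith
  also have "\<dots> \<le> k * n (v - w) + r * n w"
    using cont[OF subspace_diff[OF VS v wV]] bound[OF w(1)] by linarith
  also have "\<dots> \<le> \<bar>k\<bar> * n (v - w) + r * (n (v - w) + n v)"
    using normed_space_on_triangle[OF V subspace_diff[OF VS wV v] v] r nn
      normed_space_on_minus_commute[OF V v wV]
    by (intro add_mono mult_right_mono mult_left_mono) auto
  also have "\<dots> = r * n v + (\<bar>k\<bar> + r) * n (v - w)" by (simp add: algebra_simps)
  also have "(\<bar>k\<bar> + r) * n (v - w) \<le> (\<bar>k\<bar> + r + 1) * ?d"
    using nn w(2) r d by (intro mult_mono) auto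
  also have "\<dots> = e" using r by simp
  finally show "\<bar>g v\<bar> \<le> r * n v + e" by simp
qed

text \<open>A supremum of reals says something only if the set is bounded above, so the lower bound
  rests on the estimate of \<open>g\<close> as well.\<close>

lemma dual_norm_le:
  assumes V: "normed_space_on Z V n" and r: "0 \<le> r"
    and bound: "\<And>v. v \<in> V \<Longrightarrow> \<bar>g v\<bar> \<le> r * n v"
  shows "0 \<le> dual_norm V n g" "dual_norm V n g \<le> r"
proof -
  have zero: "0 \<in> {u \<in> V. n u \<le> 1}"
    using normed_space_on_zero[OF V] subspace_0[OF normed_space_on_subspace[OF V]] by simp
  have le: "\<bar>g u\<bar> \<le> r" if "u \<in> {u \<in> V. n u \<le> 1}" for u
    using bound[of u] mult_left_mono[of "n u" 1 r] that r by auto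
  show "dual_norm V n g \<le> r"
    unfolding dual_norm_def using zero le by (intro cSUP_least) blast+
  show "0 \<le> dual_norm V n g"
    unfolding dual_norm_def
    by (rule order_trans[OF abs_ge_zero cSUP_upper[OF zero]]) (rule bdd_aboveI2[OF le])
qed

section \<open>Well-posedness tested on the dense subspaces\<close>

text \<open>Every \<open>u\<close> solves the problem whose right-hand side is its own functional
  \<open>b u\<close>. Continuous dependence on the data thereby becomes an inf-sup estimate, and
  density allows test functions from \<open>Y0\<close> only.\<close>

lemma well_posed_stability:
  assumes X: "normed_space_on Z X nX" and Y: "normed_space_on Z' Y nY"
    and dense: "dense_in_norm Y0 Y nY" and wp: "well_posed Z X nX Y nY b f"
  obtains K where "0 \<le> K"
    "\<And>u r. u \<in> X \<Longrightarrow> 0 \<le> r \<Longrightarrow> (\<And>v. v \<in> Y0 \<Longrightarrow> \<bar>b u v\<bar> \<le> r * nY v) \<Longrightarrow> nX u \<le> K * r"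
proof -
  obtain k where k: "\<And>u v. u \<in> X \<Longrightarrow> v \<in> Y \<Longrightarrow> \<bar>b u v\<bar> \<le> k * nX u * nY v"
    using wp unfolding well_posed_def continuous_bilinear_form_on_def by blast
  have bil: "bilinear_form_on X Y b"
    using wp unfolding well_posed_def continuous_bilinear_form_on_def by blast
  obtain K where K: "\<And>g u. g \<in> dual_space Y nY \<Longrightarrow> solves X Y b g u \<Longrightarrow> nX u \<le> K * dual_norm Y nY g"
    using wp unfolding well_posed_def by blast
  show thesis
  proof
    show "0 \<le> \<bar>K\<bar>" by simp
    fix u r assume u: "u \<in> X" and r: "0 \<le> r" and bound: "\<And>v. v \<in> Y0 \<Longrightarrow> \<bar>b u v\<bar> \<le> r * nY v"
    have lin: "linear_form_on Y (b u)" using bilinear_form_on_right[OF bil u] .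
    have le: "\<bar>b u v\<bar> \<le> r * nY v" if "v \<in> Y" for v
      using dense_functional_bound[OF Y dense lin r k[OF u] bound that] .
    have "nX u \<le> K * dual_norm Y nY (b u)"
      using lin le u by (intro K) (auto simp: dual_space_def solves_def)
    also have "\<dots> \<le> \<bar>K\<bar> * r"
      using dual_norm_le[OF Y r le] by (intro mult_mono) auto
    finally show "nX u \<le> \<bar>K\<bar> * r" .
  qed
qed

text \<open>A functional on \<open>Y0\<close> is not yet admissible data. It is extended to
  \<open>Y\<close>, where an exact solution exists; that solution is then replaced by a nearby
  element of \<open>X0\<close>, and continuity of \<open>b\<close> bounds the residual created by
  this.\<close>

lemma well_posed_approximate_solution:
  assumes X: "normed_space_on Z X nX" and Y: "normed_space_on Z' Y nY"
    and denseX: "dense_in_norm X0 X nX"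
    and dense: "dense_in_norm Y0 Y nY" and wp: "well_posed Z X nX Y nY b f" and Y0: "subspace Y0"
    and g: "linear_form_on Y0 g" and r: "0 \<le> r" and bound: "\<And>v. v \<in> Y0 \<Longrightarrow> \<bar>g v\<bar> \<le> r * nY v"
    and e: "0 < e"
  obtains w where "w \<in> X0" "\<And>v. v \<in> Y0 \<Longrightarrow> \<bar>b w v - g v\<bar> \<le> e * nY v"
proof -
  note XS = normed_space_on_subspace[OF X]
  obtain k where k: "\<And>u v. u \<in> X \<Longrightarrow> v \<in> Y \<Longrightarrow> \<bar>b u v\<bar> \<le> k * nX u * nY v"
    using wp unfolding well_posed_def continuous_bilinear_form_on_def by blast
  have bil: "bilinear_form_on X Y b"
    using wp unfolding well_posed_def continuous_bilinear_form_on_def by blast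
  obtain h where h: "linear_form_on Y h" "\<And>v. v \<in> Y0 \<Longrightarrow> h v = g v"
    "\<And>v. v \<in> Y \<Longrightarrow> \<bar>h v\<bar> \<le> r * nY v"
    using extend_dense_functional[OF Y dense Y0 g r bound] by blast
  then have "h \<in> dual_space Y nY" by (auto simp: dual_space_def)
  then obtain u where u: "u \<in> X" "\<And>v. v \<in> Y \<Longrightarrow> b u v = h v"
    using wp unfolding well_posed_def solves_def by blast
  have d: "0 < e / (\<bar>k\<bar> + 1)" using e by simp
  obtain w where w: "w \<in> X0" "nX (u - w) < e / (\<bar>k\<bar> + 1)"
    using denseX u(1) d unfolding dense_in_norm_def by blast
  have wX: "w \<in> X" using w(1) denseX by (auto simp: dense_in_norm_def)
  have "\<bar>b w v - g v\<bar> \<le> e * nY v" if v: "v \<in> Y0" for v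
  proof -
    have vY: "v \<in> Y" using v dense by (auto simp: dense_in_norm_def)
    have "b w v - g v = - b (u - w) v"
      using linear_form_on_diff[OF bilinear_form_on_left[OF bil vY] XS u(1) wX] u(2)[OF vY] h(2)[OF v]
      by simp
    also have "\<bar>\<dots>\<bar> \<le> k * nX (u - w) * nY v" using k[OF subspace_diff[OF XS u(1) wX] vY] by simp
    also have "\<dots> \<le> (\<bar>k\<bar> + 1) * (e / (\<bar>k\<bar> + 1)) * nY v"
      using w(2) normed_space_on_nonneg[OF Y vY] normed_space_on_nonneg[OF X subspace_diff[OF XS u(1) wX]]
      by (intro mult_right_mono mult_mono) auto
    finally show ?thesis by simp
  qed
  with w(1) show thesis by (rule that)
qed

text \<open>The estimate \<open>stable\<close> is available on \<open>X0\<close> only, and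
  \<open>u\<close> need not lie there. Some \<open>x\<close> in \<open>X0\<close> close to
  \<open>u\<close> is inserted: the functional \<open>b (x - w)\<close> is the residual of
  \<open>w\<close> up to a multiple of the distance from \<open>u\<close> to \<open>x\<close>, and
  that distance can be made arbitrarily small.\<close>

lemma well_posed_error_bound:
  assumes X: "normed_space_on Z X nX" and Y: "normed_space_on Z' Y nY"
    and denseX: "dense_in_norm X0 X nX" and dense: "dense_in_norm Y0 Y nY" and wp: "well_posed Z X nX Y nY b f"
    and X0: "subspace X0"
    and leX: "\<And>u. u \<in> X0 \<Longrightarrow> nX u \<le> C' * nX0 u" and leY: "\<And>v. v \<in> Y0 \<Longrightarrow> nY v \<le> C * nY0 v"
    and pos: "0 \<le> C'" "0 \<le> C" "0 \<le> K" "0 \<le> r"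
    and stable: "\<And>u r. u \<in> X0 \<Longrightarrow> 0 \<le> r \<Longrightarrow> (\<And>v. v \<in> Y0 \<Longrightarrow> \<bar>b u v\<bar> \<le> r * nY0 v) \<Longrightarrow> nX0 u \<le> K * r"
    and u: "solves X Y b f u" and w: "w \<in> X0"
    and residual: "\<And>v. v \<in> Y0 \<Longrightarrow> \<bar>f v - b w v\<bar> \<le> r * nY0 v"
  shows "nX (u - w) \<le> C' * K * r"
proof (rule field_le_epsilon)
  fix e :: real assume e: "0 < e"
  note XS = normed_space_on_subspace[OF X]
  obtain k where k: "\<And>u v. u \<in> X \<Longrightarrow> v \<in> Y \<Longrightarrow> \<bar>b u v\<bar> \<le> k * nX u * nY v"
    using wp unfolding well_posed_def continuous_bilinear_form_on_def by blast
  have bil: "bilinear_form_on X Y b"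
    using wp unfolding well_posed_def continuous_bilinear_form_on_def by blast
  have uX: "u \<in> X" and sol: "\<And>v. v \<in> Y \<Longrightarrow> b u v = f v" using u by (auto simp: solves_def)
  \<comment> \<open>Chosen so that the two losses add up to \<open>e\<close>: \<open>d\<close> for
    the distance from \<open>u\<close> to \<open>x\<close>, and
    \<open>C' * K * \<bar>k\<bar> * C * d\<close> through the residual.\<close>
  define d where "d = e / (C' * K * \<bar>k\<bar> * C + 1)"
  have q: "0 < C' * K * \<bar>k\<bar> * C + 1" using pos by (simp add: add_nonneg_pos)
  have d: "0 < d" unfolding d_def using q e by simp
  obtain x where x: "x \<in> X0" "nX (u - x) < d"
    using denseX uX d unfolding dense_in_norm_def by blast
  have sub: "X0 \<subseteq> X" "Y0 \<subseteq> Y" using denseX dense by (auto simp: dense_in_norm_def)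
  have xw: "x - w \<in> X0" using subspace_diff[OF X0 x(1) w] .
  have ux: "u - x \<in> X" using subspace_diff[OF XS uX] x(1) sub by auto
  have "nX0 (x - w) \<le> K * (\<bar>k\<bar> * d * C + r)"
  proof (rule stable[OF xw])
    show "0 \<le> \<bar>k\<bar> * d * C + r" using pos d by simp
    fix v assume v: "v \<in> Y0"
    then have vY: "v \<in> Y" using sub by auto
    have "b (x - w) v = (f v - b w v) - b (u - x) v"
      using linear_form_on_diff[OF bilinear_form_on_left[OF bil vY] XS] sol[OF vY]
        uX subsetD[OF sub(1) x(1)] subsetD[OF sub(1) w] by simp
    then have "\<bar>b (x - w) v\<bar> \<le> r * nY0 v + k * nX (u - x) * nY v"
      using residual[OF v] k[OF ux vY] by linarith
    also have "k * nX (u - x) * nY v \<le> \<bar>k\<bar> * d * (C * nY0 v)"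
      using x(2) d normed_space_on_nonneg[OF X ux] normed_space_on_nonneg[OF Y vY] leY[OF v]
      by (intro mult_mono) auto
    finally show "\<bar>b (x - w) v\<bar> \<le> (\<bar>k\<bar> * d * C + r) * nY0 v" by (simp add: algebra_simps)
  qed
  then have "nX (x - w) \<le> C' * (K * (\<bar>k\<bar> * d * C + r))"
    using leX[OF xw] pos by (meson mult_left_mono order_trans)
  moreover have "nX (u - w) \<le> nX (u - x) + nX (x - w)"
    using normed_space_on_triangle_diff[OF X uX, of x w] x(1) w sub by auto
  ultimately have "nX (u - w) \<le> C' * K * r + (C' * K * \<bar>k\<bar> * C + 1) * d"
    using x(2) by (simp add: algebra_simps)
  also have "\<dots> = C' * K * r + e" unfolding d_def using q by simp
  finally show "nX (u - w) \<le> C' * K * r + e" .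
qed

section \<open>Multi-indices and monomials\<close>

text \<open>Extensional functions make this set finite, and changing an entry in \<open>I\<close>
  keeps a function extensional, so a shift by a unit index is a plain function update.\<close>

definition multi_indices :: "'i set \<Rightarrow> nat \<Rightarrow> ('i \<Rightarrow> nat) set" where
  "multi_indices I k = {\<alpha> \<in> I \<rightarrow>\<^sub>E UNIV. sum \<alpha> I = k}"

lemma multi_indices_subset:
  assumes "finite I" "k < m"
  shows "multi_indices I k \<subseteq> I \<rightarrow>\<^sub>E {..<m}"
proof
  fix \<alpha> assume \<alpha>: "\<alpha> \<in> multi_indices I k"
  have "\<alpha> i < m" if "i \<in> I" for i
    using member_le_sum[OF that, of \<alpha>] assms \<alpha> by (auto simp: multi_indices_def)
  then show "\<alpha> \<in> I \<rightarrow>\<^sub>E {..<m}" using \<alpha> by (auto simp: multi_indices_def PiE_iff)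
qed

lemma
  assumes "finite I"
  shows finite_multi_indices: "finite (multi_indices I k)"
    and card_multi_indices_le: "card (multi_indices I k) \<le> Suc k ^ card I"
proof -
  have sub: "multi_indices I k \<subseteq> I \<rightarrow>\<^sub>E {..<Suc k}"
    using multi_indices_subset[OF assms, of k "Suc k"] by simp
  have fin: "finite (I \<rightarrow>\<^sub>E {..<Suc k})" using assms by (intro finite_PiE) auto
  show "finite (multi_indices I k)" using sub fin by (rule finite_subset)
  show "card (multi_indices I k) \<le> Suc k ^ card I"
    using card_mono[OF fin sub] by (simp add: card_PiE[OF assms])
qed

lemma multi_indices_0: "finite I \<Longrightarrow> multi_indices I 0 = {\<lambda>i\<in>I. 0}"
  by (auto simp: multi_indices_def PiE_iff extensional_def fun_eq_iff)

text \<open>The pairs (\<alpha>, i) with \<open>0 < \<alpha> i\<close> correspond to the pairs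
  (\<beta>, i) by \<alpha> = \<beta> + e_i, and the monomial of \<alpha> is
  \<open>\<delta> i\<close> times that of \<beta>. This is one step of the Neumann series:
  coefficient by coefficient on the left, applied to the whole homogeneous part of degree
  \<open>k\<close> on the right.\<close>

lemma sum_multi_indices_Suc:
  fixes c :: "'i \<Rightarrow> ('i \<Rightarrow> nat) \<Rightarrow> real"
  assumes I: "finite I"
  shows "(\<Sum>\<alpha>\<in>multi_indices I (Suc k).
            (\<Prod>j\<in>I. \<delta> j ^ \<alpha> j) * (\<Sum>i\<in>{i \<in> I. 0 < \<alpha> i}. c i (\<alpha>(i := \<alpha> i - 1))))
       = (\<Sum>\<beta>\<in>multi_indices I k. (\<Prod>j\<in>I. \<delta> j ^ \<beta> j) * (\<Sum>i\<in>I. \<delta> i * c i \<beta>))"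
proof -
  have step: "(\<Sum>\<alpha>\<in>{\<alpha> \<in> multi_indices I (Suc k). 0 < \<alpha> i}.
            (\<Prod>j\<in>I. \<delta> j ^ \<alpha> j) * c i (\<alpha>(i := \<alpha> i - 1)))
       = (\<Sum>\<beta>\<in>multi_indices I k. (\<Prod>j\<in>I. \<delta> j ^ \<beta> j) * (\<delta> i * c i \<beta>))" if i: "i \<in> I" for i
  proof (rule sum.reindex_bij_witness[where
        i = "\<lambda>\<beta>. \<beta>(i := Suc (\<beta> i))" and j = "\<lambda>\<alpha>. \<alpha>(i := \<alpha> i - 1)"])
    have s: "sum (\<alpha>(i := x)) I + \<alpha> i = sum \<alpha> I + x" for \<alpha> and x :: nat
      using I i by (simp add: sum.remove[of I i])
    fix \<alpha> assume "\<alpha> \<in> {\<alpha> \<in> multi_indices I (Suc k). 0 < \<alpha> i}"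
    then have \<alpha>: "\<alpha> \<in> multi_indices I (Suc k)" "0 < \<alpha> i" by auto
    show "(\<alpha>(i := \<alpha> i - 1))(i := Suc ((\<alpha>(i := \<alpha> i - 1)) i)) = \<alpha>" using \<alpha> by auto
    show "\<alpha>(i := \<alpha> i - 1) \<in> multi_indices I k"
      using \<alpha> s[of \<alpha> "\<alpha> i - 1"] i by (auto simp: multi_indices_def PiE_iff extensional_def)
    have "(\<Prod>j\<in>I. \<delta> j ^ \<alpha> j) = \<delta> i * (\<Prod>j\<in>I. \<delta> j ^ (\<alpha>(i := \<alpha> i - 1)) j)"
    proof -
      have "(\<Prod>j\<in>I - {i}. \<delta> j ^ (\<alpha>(i := \<alpha> i - 1)) j) = (\<Prod>j\<in>I - {i}. \<delta> j ^ \<alpha> j)"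
        by (intro prod.cong) auto
      moreover have "\<delta> i ^ \<alpha> i = \<delta> i * \<delta> i ^ (\<alpha> i - 1)"
        using \<alpha>(2) by (cases "\<alpha> i") auto
      ultimately show ?thesis
        unfolding prod.remove[OF I i, of "\<lambda>j. \<delta> j ^ \<alpha> j"]
          prod.remove[OF I i, of "\<lambda>j. \<delta> j ^ (\<alpha>(i := \<alpha> i - 1)) j"]
        by (simp only: fun_upd_same mult.assoc)
    qed
    then show "(\<Prod>j\<in>I. \<delta> j ^ (\<alpha>(i := \<alpha> i - 1)) j) * (\<delta> i * c i (\<alpha>(i := \<alpha> i - 1)))
        = (\<Prod>j\<in>I. \<delta> j ^ \<alpha> j) * c i (\<alpha>(i := \<alpha> i - 1))"
      by (simp add: mult_ac)
  next
    have s: "sum (\<alpha>(i := x)) I + \<alpha> i = sum \<alpha> I + x" for \<alpha> and x :: nat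
      using I i by (simp add: sum.remove[of I i])
    fix \<beta> assume \<beta>: "\<beta> \<in> multi_indices I k"
    show "\<beta>(i := Suc (\<beta> i)) \<in> {\<alpha> \<in> multi_indices I (Suc k). 0 < \<alpha> i}"
      using \<beta> s[of \<beta> "Suc (\<beta> i)"] i by (auto simp: multi_indices_def PiE_iff extensional_def)
  qed auto
  have "(\<Sum>\<alpha>\<in>multi_indices I (Suc k).
            (\<Prod>j\<in>I. \<delta> j ^ \<alpha> j) * (\<Sum>i\<in>{i \<in> I. 0 < \<alpha> i}. c i (\<alpha>(i := \<alpha> i - 1))))
     = (\<Sum>\<alpha>\<in>multi_indices I (Suc k). \<Sum>i\<in>{i \<in> I. 0 < \<alpha> i}.
            (\<Prod>j\<in>I. \<delta> j ^ \<alpha> j) * c i (\<alpha>(i := \<alpha> i - 1)))"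
    by (simp add: sum_distrib_left)
  also have "\<dots> = (\<Sum>i\<in>I. \<Sum>\<alpha>\<in>{\<alpha> \<in> multi_indices I (Suc k). 0 < \<alpha> i}.
            (\<Prod>j\<in>I. \<delta> j ^ \<alpha> j) * c i (\<alpha>(i := \<alpha> i - 1)))"
    by (rule sum.swap_restrict[OF finite_multi_indices[OF I] I])
  also have "\<dots> = (\<Sum>i\<in>I. \<Sum>\<beta>\<in>multi_indices I k. (\<Prod>j\<in>I. \<delta> j ^ \<beta> j) * (\<delta> i * c i \<beta>))"
    by (intro sum.cong refl step)
  also have "\<dots> = (\<Sum>\<beta>\<in>multi_indices I k. \<Sum>i\<in>I. (\<Prod>j\<in>I. \<delta> j ^ \<beta> j) * (\<delta> i * c i \<beta>))"
    by (rule sum.swap)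
  finally show ?thesis by (simp add: sum_distrib_left)
qed

lemma monomial_abs_le:
  fixes \<delta> :: "'i \<Rightarrow> real"
  assumes "\<alpha> \<in> multi_indices I k" "\<And>i. i \<in> I \<Longrightarrow> \<bar>\<delta> i\<bar> \<le> \<eta>"
  shows "\<bar>\<Prod>j\<in>I. \<delta> j ^ \<alpha> j\<bar> \<le> \<eta> ^ k"
proof -
  have "\<bar>\<Prod>j\<in>I. \<delta> j ^ \<alpha> j\<bar> = (\<Prod>j\<in>I. \<bar>\<delta> j\<bar> ^ \<alpha> j)" by (simp add: abs_prod power_abs)
  also have "\<dots> \<le> (\<Prod>j\<in>I. \<eta> ^ \<alpha> j)" using assms by (intro prod_mono) (auto intro: power_mono)
  also have "\<dots> = \<eta> ^ k" using assms(1) by (simp add: power_sum[symmetric] multi_indices_def)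
  finally show ?thesis .
qed

text \<open>It pays for the number of coefficients: an error 4^-m in each of polynomially many terms
  becomes 2^-m in their sum, up to a constant.\<close>

lemma polynomial_le_exponential:
  obtains a :: real where "0 \<le> a" "\<And>m. real (Suc m) ^ k \<le> a * 2 ^ m"
proof -
  have "(\<lambda>m. real (Suc m) ^ k / 2 ^ m) \<longlonglongrightarrow> 0" by real_asymp
  then have "Bseq (\<lambda>m. real (Suc m) ^ k / 2 ^ m)"
    using convergent_imp_Bseq convergentI by blast
  then obtain a where "0 < a" "\<And>m. \<bar>real (Suc m) ^ k / 2 ^ m\<bar> \<le> a"
    unfolding Bseq_def real_norm_def by blast
  then show thesis by (intro that[of a]) (auto simp: field_simps)
qed

section \<open>Approximate Taylor expansion around one form\<close>

text \<open>\<open>stable\<close> and \<open>solvable\<close> replace the inverse of the operator of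
  \<open>a\<close>: it is bounded below and has dense range in the dual. Exact solvability would be
  too much to ask, as \<open>V\<close> need not be complete. The \<open>c i\<close> are the
  directions of perturbation, with one bound \<open>M\<close> for all. Taking \<open>K\<close> at
  least 1 allows tolerances to be absorbed into growth constants.\<close>

locale form_perturbation =
  fixes I :: "'i set" and V Z :: "'v::real_vector set" and W Z' :: "'w::real_vector set"
    and nV :: "'v \<Rightarrow> real" and nW :: "'w \<Rightarrow> real"
    and a :: "'v \<Rightarrow> 'w \<Rightarrow> real" and c :: "'i \<Rightarrow> 'v \<Rightarrow> 'w \<Rightarrow> real" and K M0 M :: real
  assumes I: "finite I" and V: "normed_space_on Z V nV" and W: "normed_space_on Z' W nW"
    and K: "1 \<le> K"
    and stable: "\<And>u r. u \<in> V \<Longrightarrow> 0 \<le> r \<Longrightarrow> (\<And>v. v \<in> W \<Longrightarrow> \<bar>a u v\<bar> \<le> r * nW v) \<Longrightarrow> nV u \<le> K * r"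
    and solvable: "\<And>g e. g \<in> dual_space W nW \<Longrightarrow> 0 < e \<Longrightarrow> \<exists>u\<in>V. \<forall>v\<in>W. \<bar>a u v - g v\<bar> \<le> e * nW v"
    and a: "bilinear_form_on V W a"
    and M0: "0 \<le> M0" "\<And>u v. u \<in> V \<Longrightarrow> v \<in> W \<Longrightarrow> \<bar>a u v\<bar> \<le> M0 * nV u * nW v"
    and c: "\<And>i. i \<in> I \<Longrightarrow> bilinear_form_on V W (c i)"
    and M: "0 \<le> M" "\<And>i u v. i \<in> I \<Longrightarrow> u \<in> V \<Longrightarrow> v \<in> W \<Longrightarrow> \<bar>c i u v\<bar> \<le> M * nV u * nW v"
begin

text \<open>The exact coefficients satisfy a(u_0, v) = g(v), and a(u_\<alpha>, v) is minus the sum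
  of c_i(u_{\<alpha> - e_i}, v); each equation is solved up to \<open>e\<close>. Only
  \<open>U k \<alpha>\<close> with \<alpha> of degree \<open>k\<close> is a genuine coefficient.
  Keeping \<open>k\<close> as a separate argument makes the recursion primitive in \<open>k\<close>,
  without any condition on \<alpha>.\<close>

lemma taylor_coefficients:
  fixes e G :: real
  assumes g: "linear_form_on W g" and G: "0 \<le> G" "\<forall>v\<in>W. \<bar>g v\<bar> \<le> G * nW v"
    and e: "0 < e" "e \<le> 1"
  obtains U :: "nat \<Rightarrow> ('i \<Rightarrow> nat) \<Rightarrow> 'v"
  where "\<And>k \<alpha>. U k \<alpha> \<in> V"
    and "\<And>k \<alpha>. nV (U k \<alpha>) \<le> K * (G + 1) * (K * (card I * M + 1)) ^ k"
    and "\<And>\<alpha> v. v \<in> W \<Longrightarrow> \<bar>a (U 0 \<alpha>) v - g v\<bar> \<le> e * nW v"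
    and "\<And>k \<alpha> v. v \<in> W \<Longrightarrow>
      \<bar>a (U (Suc k) \<alpha>) v + (\<Sum>i\<in>{i \<in> I. 0 < \<alpha> i}. c i (U k (\<alpha>(i := \<alpha> i - 1))) v)\<bar> \<le> e * nW v"
proof -
  \<comment> \<open>\<open>S\<close> chooses an approximate solution for each functional. It need
    not be linear, so it is never distributed over a sum; only its residuals are used.\<close>
  have "\<forall>g\<in>dual_space W nW. \<exists>u. u \<in> V \<and> (\<forall>v\<in>W. \<bar>a u v - g v\<bar> \<le> e * nW v)"
    using solvable e by blast
  then obtain S where S: "\<And>g. g \<in> dual_space W nW \<Longrightarrow> S g \<in> V"
    "\<And>g v. g \<in> dual_space W nW \<Longrightarrow> v \<in> W \<Longrightarrow> \<bar>a (S g) v - g v\<bar> \<le> e * nW v"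
    by (metis (no_types, lifting) bchoice)
  have S_bound: "nV (S h) \<le> K * (H + e)"
    if h: "h \<in> dual_space W nW" and H: "0 \<le> H" "\<And>v. v \<in> W \<Longrightarrow> \<bar>h v\<bar> \<le> H * nW v" for h H
  proof (rule stable)
    fix v assume v: "v \<in> W"
    show "\<bar>a (S h) v\<bar> \<le> (H + e) * nW v"
      using S(2)[OF h v] H(2)[OF v] unfolding distrib_right by linarith
  qed (use S(1)[OF h] H e in auto)
  define rhs where "rhs u \<alpha> v = (\<Sum>i\<in>{i \<in> I. 0 < \<alpha> i}. (-1) * c i (u (\<alpha>(i := \<alpha> i - 1))) v)"
    for u and \<alpha> :: "'i \<Rightarrow> nat" and v
  have rhs_bound: "\<bar>rhs u \<alpha> v\<bar> \<le> (card I * M * B) * nW v"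
    if u: "\<And>\<alpha>. u \<alpha> \<in> V" "\<And>\<alpha>. nV (u \<alpha>) \<le> B" and v: "v \<in> W" for u \<alpha> v and B :: real
  proof -
    have nn: "0 \<le> M * B * nW v"
      using M(1) normed_space_on_nonneg[OF W v] order_trans[OF normed_space_on_nonneg[OF V u(1)] u(2)]
      by simp
    have "\<bar>rhs u \<alpha> v\<bar> \<le> (\<Sum>i\<in>{i \<in> I. 0 < \<alpha> i}. M * B * nW v)"
      unfolding rhs_def
    proof (rule order_trans[OF sum_abs sum_mono])
      fix i assume "i \<in> {i \<in> I. 0 < \<alpha> i}"
      then have i: "i \<in> I" by simp
      have "\<bar>- 1 * c i (u (\<alpha>(i := \<alpha> i - 1))) v\<bar> \<le> M * nV (u (\<alpha>(i := \<alpha> i - 1))) * nW v"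
        using M(2)[OF i u(1) v] by simp
      also have "\<dots> \<le> M * B * nW v"
        using u(2) M(1) normed_space_on_nonneg[OF W v] by (intro mult_right_mono mult_left_mono)
      finally show "\<bar>- 1 * c i (u (\<alpha>(i := \<alpha> i - 1))) v\<bar> \<le> M * B * nW v" .
    qed
    also have "\<dots> \<le> (\<Sum>i\<in>I. M * B * nW v)" using I nn by (intro sum_mono2) auto
    finally show ?thesis by (simp add: mult_ac)
  qed
  have rhs_dual: "rhs u \<alpha> \<in> dual_space W nW"
    if u: "\<And>\<alpha>. u \<alpha> \<in> V" "\<And>\<alpha>. nV (u \<alpha>) \<le> B" for u \<alpha> and B :: real
  proof -
    have "linear_form_on W (rhs u \<alpha>)"
      unfolding rhs_def using u(1) by (intro linear_form_on_sum_mult bilinear_form_on_right[OF c]) auto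
    moreover have "\<forall>v\<in>W. \<bar>rhs u \<alpha> v\<bar> \<le> (card I * M * B) * nW v"
      using rhs_bound[where u = u and \<alpha> = \<alpha> and B = B] u by auto
    ultimately show ?thesis unfolding dual_space_def by blast
  qed
  define U where "U = rec_nat (\<lambda>\<alpha>. S g) (\<lambda>k u \<alpha>. S (rhs u \<alpha>))"
  have U: "U 0 \<alpha> = S g" "U (Suc k) \<alpha> = S (rhs (U k) \<alpha>)" for k \<alpha> by (simp_all add: U_def)
  have gd: "g \<in> dual_space W nW" using g G by (auto simp: dual_space_def)
  define D where "D = K * (G + 1)"
  define L where "L = K * (card I * M + 1)"
  \<comment> \<open>With \<open>D\<close> and \<open>L\<close> at least 1 the bound
    \<open>D * L ^ k\<close> stays above the tolerance \<open>e\<close> at every degree. The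
    summands 1 in \<open>D\<close> and \<open>L\<close> then absorb that tolerance.\<close>
  have D: "1 \<le> D" unfolding D_def using K G(1) mult_mono[of 1 K 1 "G + 1"] by simp
  have L: "1 \<le> L" unfolding L_def using K M(1) mult_mono[of 1 K 1 "card I * M + 1"] by simp
  have inv: "\<forall>\<alpha>. U k \<alpha> \<in> V \<and> nV (U k \<alpha>) \<le> D * L ^ k" for k
  proof (induction k)
    case 0
    have "K * (G + e) \<le> D" unfolding D_def using e K by (intro mult_left_mono) auto
    then show ?case using S(1)[OF gd] S_bound[OF gd G(1)] G(2) by (auto simp: U)
  next
    case (Suc k)
    then have IH: "\<And>\<alpha>. U k \<alpha> \<in> V" "\<And>\<alpha>. nV (U k \<alpha>) \<le> D * L ^ k" by auto
    have DL: "1 \<le> D * L ^ k" using mult_mono[OF D one_le_power[OF L, of k]] D by simp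
    have "nV (U (Suc k) \<alpha>) \<le> K * (card I * M * (D * L ^ k) + e)" for \<alpha>
      unfolding U using M(1) DL by (intro S_bound rhs_dual[OF IH] rhs_bound[OF IH]) auto
    also have "\<dots> \<le> K * (card I * M * (D * L ^ k) + D * L ^ k)"
      using e DL K by (intro mult_left_mono) auto
    also have "\<dots> = D * L ^ Suc k" by (simp add: L_def algebra_simps)
    finally show ?case using S(1)[OF rhs_dual[OF IH]] by (auto simp: U)
  qed
  show thesis
  proof
    show "U k \<alpha> \<in> V" for k \<alpha> using inv by blast
    show "nV (U k \<alpha>) \<le> K * (G + 1) * (K * (card I * M + 1)) ^ k" for k \<alpha>
      using inv by (auto simp: D_def L_def)
    show "\<bar>a (U 0 \<alpha>) v - g v\<bar> \<le> e * nW v" if "v \<in> W" for \<alpha> v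
      using S(2)[OF gd that] by (simp add: U)
    show "\<bar>a (U (Suc k) \<alpha>) v + (\<Sum>i\<in>{i \<in> I. 0 < \<alpha> i}. c i (U k (\<alpha>(i := \<alpha> i - 1))) v)\<bar> \<le> e * nW v"
      if "v \<in> W" for k \<alpha> v
    proof -
      have "rhs (U k) \<alpha> \<in> dual_space W nW"
        using inv by (intro rhs_dual[of "U k" "D * L ^ k"]) auto
      from S(2)[OF this that] show ?thesis by (simp add: U rhs_def sum_negf)
    qed
  qed
qed

text \<open>The span must not depend on \<delta>, so \<open>B\<close> consists of coefficients, and
  \<delta> enters only through the monomials weighting them. The box of indices with all entries
  below \<open>m\<close> has \<open>m ^ card I\<close> elements and contains every index of degree
  below \<open>m\<close>. This count is the origin of the exponent 1/Q_b in the width.\<close>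

lemma taylor_approximation:
  fixes G \<eta> :: real
  assumes g: "linear_form_on W g" and G: "0 \<le> G" "\<forall>v\<in>W. \<bar>g v\<bar> \<le> G * nW v"
    and \<eta>: "0 \<le> \<eta>" "\<eta> \<le> 1" "4 * (K * (card I * M + 1)) * \<eta> \<le> 1"
  obtains A where "0 \<le> A"
    "\<And>m. \<exists>B\<subseteq>V. finite B \<and> card B \<le> m ^ card I \<and>
      (\<forall>\<delta>. (\<forall>i\<in>I. \<bar>\<delta> i\<bar> \<le> \<eta>) \<longrightarrow> (\<exists>w\<in>span B. \<forall>v\<in>W.
        \<bar>g v - (a w v + (\<Sum>i\<in>I. \<delta> i * c i w v))\<bar> \<le> A / 2 ^ m * nW v))"
proof -
  note VS = normed_space_on_subspace[OF V]
  define D where "D = K * (G + 1)"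
  define L where "L = K * (card I * M + 1)"
  have D: "0 \<le> D" unfolding D_def using K G(1) by simp
  have L: "0 \<le> L" unfolding L_def using K M(1) by simp
  obtain A0 where A0: "0 \<le> A0" "\<And>m. real (Suc m) ^ Suc (card I) \<le> A0 * 2 ^ m"
    using polynomial_le_exponential[of "Suc (card I)"] by metis
  \<comment> \<open>\<open>M0 * D\<close> stems from the first omitted degree, 1 from the
    accumulated tolerances, and \<open>A0\<close> from the polynomial count.\<close>
  define A where "A = A0 * (M0 * D + 1)"
  have "\<exists>B\<subseteq>V. finite B \<and> card B \<le> m ^ card I \<and>
      (\<forall>\<delta>. (\<forall>i\<in>I. \<bar>\<delta> i\<bar> \<le> \<eta>) \<longrightarrow> (\<exists>w\<in>span B. \<forall>v\<in>W.
        \<bar>g v - (a w v + (\<Sum>i\<in>I. \<delta> i * c i w v))\<bar> \<le> A / 2 ^ m * nW v))" for m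
  proof -
    define e :: real where "e = 1 / 4 ^ m"
    have e: "0 < e" "e \<le> 1" by (auto simp: e_def)
    obtain U :: "nat \<Rightarrow> ('i \<Rightarrow> nat) \<Rightarrow> 'v" where U: "\<And>k \<alpha>. U k \<alpha> \<in> V"
      "\<And>k \<alpha>. nV (U k \<alpha>) \<le> D * L ^ k"
      "\<And>\<alpha> v. v \<in> W \<Longrightarrow> \<bar>a (U 0 \<alpha>) v - g v\<bar> \<le> e * nW v"
      "\<And>k \<alpha> v. v \<in> W \<Longrightarrow>
        \<bar>a (U (Suc k) \<alpha>) v + (\<Sum>i\<in>{i \<in> I. 0 < \<alpha> i}. c i (U k (\<alpha>(i := \<alpha> i - 1))) v)\<bar> \<le> e * nW v"
      by (rule taylor_coefficients[OF g G e, folded D_def L_def]) blast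
    define B where "B = (\<lambda>\<alpha>. U (sum \<alpha> I) \<alpha>) ` (I \<rightarrow>\<^sub>E {..<m})"
    have fin: "finite (I \<rightarrow>\<^sub>E {..<m})" using I by (intro finite_PiE) auto
    have "card B \<le> m ^ card I"
      using card_image_le[OF fin, of "\<lambda>\<alpha>. U (sum \<alpha> I) \<alpha>"] unfolding B_def by (simp add: card_PiE[OF I])
    moreover have "\<exists>w\<in>span B. \<forall>v\<in>W. \<bar>g v - (a w v + (\<Sum>i\<in>I. \<delta> i * c i w v))\<bar> \<le> A / 2 ^ m * nW v"
      if \<delta>: "\<And>i. i \<in> I \<Longrightarrow> \<bar>\<delta> i\<bar> \<le> \<eta>" for \<delta>
    proof -
      define mono where "mono \<alpha> = (\<Prod>j\<in>I. \<delta> j ^ \<alpha> j)" for \<alpha>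
      define h where "h k = (\<Sum>\<alpha>\<in>multi_indices I k. mono \<alpha> *\<^sub>R U k \<alpha>)" for k
      \<comment> \<open>\<open>h k\<close> is the homogeneous part of degree \<open>k\<close> of the
        approximate series. \<open>E k\<close> is the defect in its recursion, where degree 0 has
        \<open>g\<close> as its datum.\<close>
      define E where "E k v = a (h k) v - (case k of 0 \<Rightarrow> g v | Suc j \<Rightarrow> - (\<Sum>i\<in>I. \<delta> i * c i (h j) v))" for k v
      have hV: "h k \<in> V" for k
        unfolding h_def using U(1) by (intro subspace_sum[OF VS] subspace_scale[OF VS])
      have form_h: "b (h k) v = (\<Sum>\<alpha>\<in>multi_indices I k. mono \<alpha> * b (U k \<alpha>) v)"
        if "bilinear_form_on V W b" "v \<in> W" for b k v
        unfolding h_def using U(1)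
        by (intro linear_form_on_sum[OF bilinear_form_on_left[OF that] VS finite_multi_indices[OF I]])
      have mono_le: "\<bar>mono \<alpha>\<bar> \<le> \<eta> ^ k" if "\<alpha> \<in> multi_indices I k" for \<alpha> k
        unfolding mono_def using monomial_abs_le[OF that \<delta>] by simp
      have mono_le1: "\<bar>mono \<alpha>\<bar> \<le> 1" if "\<alpha> \<in> multi_indices I k" for \<alpha> k
        using mono_le[OF that] power_le_one[OF \<eta>(1,2), of k] by linarith
      have E_sum: "\<bar>E k v\<bar> \<le> real (Suc k ^ card I) * (e * nW v)" if v: "v \<in> W" for k v
      proof -
        have sum_le: "\<bar>\<Sum>\<alpha>\<in>multi_indices I k. mono \<alpha> * r \<alpha>\<bar> \<le> real (Suc k ^ card I) * (e * nW v)"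
          if r: "\<And>\<alpha>. \<bar>r \<alpha>\<bar> \<le> e * nW v" for r
        proof -
          have "\<bar>\<Sum>\<alpha>\<in>multi_indices I k. mono \<alpha> * r \<alpha>\<bar> \<le> (\<Sum>\<alpha>\<in>multi_indices I k. 1 * (e * nW v))"
          proof (rule order_trans[OF sum_abs sum_mono])
            fix \<alpha> assume \<alpha>: "\<alpha> \<in> multi_indices I k"
            show "\<bar>mono \<alpha> * r \<alpha>\<bar> \<le> 1 * (e * nW v)"
              unfolding abs_mult using mono_le1[OF \<alpha>] r by (intro mult_mono) auto
          qed
          also have "\<dots> \<le> real (Suc k ^ card I) * (e * nW v)"
            using card_multi_indices_le[OF I, of k] e normed_space_on_nonneg[OF W v]
            by (simp only: sum_constant mult_1_left) (intro mult_right_mono, auto simp flip: of_nat_power)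
          finally show ?thesis .
        qed
        show ?thesis
        proof (cases k)
          case 0
          have "E k v = (\<Sum>\<alpha>\<in>multi_indices I k. mono \<alpha> * (a (U 0 \<alpha>) v - g v))"
            using form_h[OF a v, of 0] by (simp add: E_def 0 multi_indices_0[OF I] mono_def)
          then show ?thesis using sum_le[of "\<lambda>\<alpha>. a (U 0 \<alpha>) v - g v"] U(3)[OF v] by simp
        next
          case (Suc j)
          \<comment> \<open>Regrouping by the multi-index of degree \<open>k\<close> turns the
            defect of \<open>h k\<close> into a combination of the defects of the single
            coefficients, weighted by monomials of modulus at most 1.\<close>
          have "(\<Sum>i\<in>I. \<delta> i * c i (h j) v)
              = (\<Sum>\<beta>\<in>multi_indices I j. mono \<beta> * (\<Sum>i\<in>I. \<delta> i * c i (U j \<beta>) v))"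
            by (simp add: form_h[OF c v] sum_distrib_left mult_ac) (rule sum.swap)
          also have "\<dots> = (\<Sum>\<alpha>\<in>multi_indices I k. mono \<alpha> * (\<Sum>i\<in>{i \<in> I. 0 < \<alpha> i}. c i (U j (\<alpha>(i := \<alpha> i - 1))) v))"
            unfolding mono_def Suc
            using sum_multi_indices_Suc[OF I, of \<delta> "\<lambda>i \<beta>. c i (U j \<beta>) v" j] by simp
          finally have "E k v = (\<Sum>\<alpha>\<in>multi_indices I k. mono \<alpha> * (a (U (Suc j) \<alpha>) v
              + (\<Sum>i\<in>{i \<in> I. 0 < \<alpha> i}. c i (U j (\<alpha>(i := \<alpha> i - 1))) v)))"
            using form_h[OF a v, of k] by (simp add: E_def Suc distrib_left sum.distrib)
          then show ?thesis using sum_le U(4)[OF v] by simp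
        qed
      qed
      define w where "w = (\<Sum>k<m. h k)"
      have wV: "w \<in> V" unfolding w_def using hV by (intro subspace_sum[OF VS])
      have "w \<in> span B"
        unfolding w_def h_def
      proof (intro span_sum span_scale span_base)
        fix k \<alpha> assume "k \<in> {..<m}" and \<alpha>: "\<alpha> \<in> multi_indices I k"
        then have "\<alpha> \<in> I \<rightarrow>\<^sub>E {..<m}" using multi_indices_subset[OF I, of k m] by auto
        moreover have "sum \<alpha> I = k" using \<alpha> by (simp add: multi_indices_def)
        ultimately show "U k \<alpha> \<in> B" unfolding B_def by force
      qed
      moreover have "\<bar>g v - (a w v + (\<Sum>i\<in>I. \<delta> i * c i w v))\<bar> \<le> A / 2 ^ m * nW v" if v: "v \<in> W" for v
      proof -
        have nv: "0 \<le> nW v" using normed_space_on_nonneg[OF W v] .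
        have form_w: "b w v = (\<Sum>k<m. b (h k) v)" if "bilinear_form_on V W b" for b
          unfolding w_def
          using linear_form_on_sum[OF bilinear_form_on_left[OF that v] VS, of "{..<m}" h "\<lambda>_. 1"] hV by simp
        \<comment> \<open>The residual telescopes: each perturbation term cancels against the next
          degree up to its \<open>E\<close>. What remains is \<open>h m\<close>, so the coefficients
          of degree \<open>m\<close> must be bounded although they do not enter
          \<open>w\<close>.\<close>
        have "g v - (\<Sum>k<j. a (h k) v + (\<Sum>i\<in>I. \<delta> i * c i (h k) v)) = a (h j) v - (\<Sum>k\<le>j. E k v)" for j
          by (induction j) (auto simp: E_def algebra_simps)
        from this[of m] have res: "g v - (a w v + (\<Sum>i\<in>I. \<delta> i * c i w v)) = a (h m) v - (\<Sum>k\<le>m. E k v)"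
          by (simp add: form_w[OF a] form_w[OF c] sum.distrib sum_distrib_left) (subst sum.swap, simp)
        have "\<bar>\<Sum>k\<le>m. E k v\<bar> \<le> (\<Sum>k\<le>m. real (Suc m) ^ card I * (e * nW v))"
        proof (rule order_trans[OF sum_abs sum_mono])
          fix k assume "k \<in> {..m}"
          then have "real (Suc k ^ card I) \<le> real (Suc m) ^ card I" by (simp add: power_mono)
          then have "real (Suc k ^ card I) * (e * nW v) \<le> real (Suc m) ^ card I * (e * nW v)"
            using e nv by (intro mult_right_mono) auto
          then show "\<bar>E k v\<bar> \<le> real (Suc m) ^ card I * (e * nW v)" using E_sum[OF v, of k] by linarith
        qed
        then have 1: "\<bar>\<Sum>k\<le>m. E k v\<bar> \<le> real (Suc m) ^ Suc (card I) * e * nW v" by (simp add: mult_ac)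
        have "nV (h m) \<le> (\<Sum>\<alpha>\<in>multi_indices I m. nV (mono \<alpha> *\<^sub>R U m \<alpha>))"
          unfolding h_def using U(1)
          by (intro normed_space_on_sum[OF V finite_multi_indices[OF I]] subspace_scale[OF VS])
        also have "\<dots> \<le> (\<Sum>\<alpha>\<in>multi_indices I m. D * e)"
        proof (rule sum_mono)
          fix \<alpha> assume \<alpha>: "\<alpha> \<in> multi_indices I m"
          have "nV (mono \<alpha> *\<^sub>R U m \<alpha>) \<le> \<eta> ^ m * (D * L ^ m)"
            unfolding normed_space_on_scale[OF V U(1)]
            using mono_le[OF \<alpha>] U(2) normed_space_on_nonneg[OF V U(1)] \<eta>(1) by (intro mult_mono) auto
          also have "\<dots> = D * (L * \<eta>) ^ m" by (simp add: power_mult_distrib)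
          \<comment> \<open>Here the factor 4 in the bound on \<eta> is spent: it makes
            \<open>L * \<eta>\<close> at most 1/4, which beats the growth of the
            coefficients.\<close>
          also have "(L * \<eta>) ^ m \<le> (1 / 4) ^ m"
            using \<eta> L unfolding L_def[symmetric] by (intro power_mono) auto
          finally show "nV (mono \<alpha> *\<^sub>R U m \<alpha>) \<le> D * e"
            using D by (simp add: e_def power_one_over mult_left_mono)
        qed
        also have "\<dots> \<le> real (Suc m ^ card I) * (D * e)"
          using card_multi_indices_le[OF I, of m] e D
          by (simp only: sum_constant) (intro mult_right_mono, auto simp flip: of_nat_power)
        \<comment> \<open>The exponent is raised by one to match the tolerance term, where the sum
          over the degrees up to \<open>m\<close> contributes one more factor.\<close>
        also have "\<dots> \<le> real (Suc m) ^ Suc (card I) * (D * e)"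
          using e D by (intro mult_right_mono) (auto intro: power_increasing[of "card I" "Suc (card I)" "1 + real m", simplified])
        finally have hm: "nV (h m) \<le> real (Suc m) ^ Suc (card I) * (D * e)" .
        have "\<bar>a (h m) v\<bar> \<le> M0 * nV (h m) * nW v" by (rule M0(2)[OF hV v])
        also have "\<dots> \<le> M0 * (real (Suc m) ^ Suc (card I) * (D * e)) * nW v"
          using hm M0(1) nv by (intro mult_right_mono mult_left_mono)
        finally have "\<bar>g v - (a w v + (\<Sum>i\<in>I. \<delta> i * c i w v))\<bar>
            \<le> M0 * (real (Suc m) ^ Suc (card I) * (D * e)) * nW v + real (Suc m) ^ Suc (card I) * e * nW v"
          unfolding res using 1 by linarith
        also have "\<dots> = real (Suc m) ^ Suc (card I) * ((M0 * D + 1) * e * nW v)" by (simp add: algebra_simps)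
        also have "\<dots> \<le> A0 * 2 ^ m * ((M0 * D + 1) * e * nW v)"
          using A0(2) M0(1) D e nv by (intro mult_right_mono) auto
        also have "\<dots> = A / 2 ^ m * nW v"
        proof -
          \<comment> \<open>One factor \<open>2 ^ m\<close> cancels against the bound for the
            polynomial; the other one is the rate.\<close>
          have "(4::real) ^ m = 2 ^ m * 2 ^ m" by (simp flip: power_mult_distrib)
          then show ?thesis by (simp add: A_def e_def field_simps)
        qed
        finally show ?thesis .
      qed
      ultimately show ?thesis by blast
    qed
    ultimately show ?thesis
      using U(1) fin by (intro exI[of _ B]) (auto simp: B_def)
  qed
  moreover have "0 \<le> A" unfolding A_def using A0(1) M0(1) D by simp
  ultimately show thesis by (rule that[rotated])
qed

end

section \<open>Local and uniform approximation of the solution section\<close>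

lemma bilinear_form_on_subset:
  assumes "bilinear_form_on V W a" "V' \<subseteq> V" "W' \<subseteq> W"
  shows "bilinear_form_on V' W' a"
  using assms unfolding bilinear_form_on_def linear_form_on_def by blast

text \<open>The sum of the absolute values is a common bound that also covers an empty index set,
  which occurs for the right-hand side if Q_f = 0.\<close>

lemma finite_uniform_bound:
  fixes Q :: "'i \<Rightarrow> real \<Rightarrow> bool"
  assumes "finite I" "\<And>i. i \<in> I \<Longrightarrow> \<exists>k. Q i k" and mono: "\<And>i k l. Q i k \<Longrightarrow> k \<le> l \<Longrightarrow> Q i l"
  obtains M where "0 \<le> M" "\<And>i. i \<in> I \<Longrightarrow> Q i M"
proof -
  obtain k where k: "\<And>i. i \<in> I \<Longrightarrow> Q i (k i)" using assms(2) by metis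
  show thesis
  proof
    show "0 \<le> (\<Sum>i\<in>I. \<bar>k i\<bar>)" by (simp add: sum_nonneg)
    fix i assume i: "i \<in> I"
    have "\<bar>k i\<bar> \<le> (\<Sum>i\<in>I. \<bar>k i\<bar>)" using assms(1) i by (intro member_le_sum) auto
    then show "Q i (\<Sum>i\<in>I. \<bar>k i\<bar>)" by (intro mono[OF k[OF i]]) linarith
  qed
qed

locale separable_problem =
  fixes P :: "'p::metric_space set" and Z X0 :: "'v::real_vector set" and Z' Y0 :: "'w::real_vector set"
    and X :: "'p \<Rightarrow> 'v set" and nX :: "'p \<Rightarrow> 'v \<Rightarrow> real" and Y :: "'p \<Rightarrow> 'w set" and nY :: "'p \<Rightarrow> 'w \<Rightarrow> real"
    and nX0 :: "'v \<Rightarrow> real" and nY0 :: "'w \<Rightarrow> real"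
    and b :: "'p \<Rightarrow> 'v \<Rightarrow> 'w \<Rightarrow> real" and f :: "'p \<Rightarrow> 'w \<Rightarrow> real" and \<sigma> :: "'p \<Rightarrow> 'v"
    and c c' C C' :: real and I :: "'i set" and J :: "'j set"
    and \<theta>b :: "'i \<Rightarrow> 'p \<Rightarrow> real" and \<theta>f :: "'j \<Rightarrow> 'p \<Rightarrow> real"
    and bi :: "'i \<Rightarrow> 'v \<Rightarrow> 'w \<Rightarrow> real" and fi :: "'j \<Rightarrow> 'w \<Rightarrow> real"
  assumes P: "compact P" and I: "finite I" and J: "finite J"
    and X: "\<And>\<mu>. \<mu> \<in> P \<Longrightarrow> normed_space_on Z (X \<mu>) (nX \<mu>)"
    and Y: "\<And>\<mu>. \<mu> \<in> P \<Longrightarrow> normed_space_on Z' (Y \<mu>) (nY \<mu>)"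
    and well_posed: "\<And>\<mu>. \<mu> \<in> P \<Longrightarrow> well_posed Z (X \<mu>) (nX \<mu>) (Y \<mu>) (nY \<mu>) (b \<mu>) (f \<mu>)"
    and solution: "\<And>\<mu>. \<mu> \<in> P \<Longrightarrow> solves (X \<mu>) (Y \<mu>) (b \<mu>) (f \<mu>) (\<sigma> \<mu>)"
    and denseX: "\<And>\<mu>. \<mu> \<in> P \<Longrightarrow> dense_in_norm X0 (X \<mu>) (nX \<mu>)"
    and denseY: "\<And>\<mu>. \<mu> \<in> P \<Longrightarrow> dense_in_norm Y0 (Y \<mu>) (nY \<mu>)"
    and X0: "normed_space_on Z X0 nX0" and Y0: "normed_space_on Z' Y0 nY0"
    and pos: "0 < c" "0 < c'" "0 < C" "0 < C'"
    and equivX: "\<And>\<mu> u. \<mu> \<in> P \<Longrightarrow> u \<in> X0 \<Longrightarrow> c' * nX0 u \<le> nX \<mu> u \<and> nX \<mu> u \<le> C' * nX0 u"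
    and equivY: "\<And>\<mu> v. \<mu> \<in> P \<Longrightarrow> v \<in> Y0 \<Longrightarrow> c * nY0 v \<le> nY \<mu> v \<and> nY \<mu> v \<le> C * nY0 v"
    and cont_b: "\<And>i. i \<in> I \<Longrightarrow> continuous_on P (\<theta>b i)"
    and cont_f: "\<And>j. j \<in> J \<Longrightarrow> continuous_on P (\<theta>f j)"
    and bi: "\<And>i. i \<in> I \<Longrightarrow> continuous_bilinear_form_on X0 nX0 Y0 nY0 (bi i)"
    and fi: "\<And>j. j \<in> J \<Longrightarrow> fi j \<in> dual_space Y0 nY0"
    and b: "\<And>\<mu> u v. \<mu> \<in> P \<Longrightarrow> u \<in> X0 \<Longrightarrow> v \<in> Y0 \<Longrightarrow> b \<mu> u v = (\<Sum>i\<in>I. \<theta>b i \<mu> * bi i u v)"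
    and f: "\<And>\<mu> v. \<mu> \<in> P \<Longrightarrow> v \<in> Y0 \<Longrightarrow> f \<mu> v = (\<Sum>j\<in>J. \<theta>f j \<mu> * fi j v)"
begin

text \<open>Well-posedness speaks of the norms at \<mu>, the expansion of the fixed norms. Passing a
  residual from \<open>nY0\<close> to \<open>nY \<mu>\<close> costs 1/\<open>c\<close>, and
  returning from \<open>nX \<mu>\<close> to \<open>nX0\<close> costs 1/\<open>c'\<close>; adding 1
  makes the constant at least 1. \<open>M\<close> is prescribed because the \<open>bi i\<close> do
  not depend on \<mu>.\<close>

lemma form_perturbation_at:
  assumes \<mu>: "\<mu> \<in> P" and M: "0 \<le> M" "\<And>i u v. i \<in> I \<Longrightarrow> u \<in> X0 \<Longrightarrow> v \<in> Y0 \<Longrightarrow> \<bar>bi i u v\<bar> \<le> M * nX0 u * nY0 v"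
  obtains K M0 where "form_perturbation I X0 Z Y0 Z' nX0 nY0 (b \<mu>) bi K M0 M"
proof -
  note wp = well_posed[OF \<mu>] and dX = denseX[OF \<mu>] and dY = denseY[OF \<mu>]
  have sub: "X0 \<subseteq> X \<mu>" "Y0 \<subseteq> Y \<mu>" using dX dY by (auto simp: dense_in_norm_def)
  obtain K1 where K1: "0 \<le> K1" "\<And>u r. u \<in> X \<mu> \<Longrightarrow> 0 \<le> r \<Longrightarrow>
      (\<And>v. v \<in> Y0 \<Longrightarrow> \<bar>b \<mu> u v\<bar> \<le> r * nY \<mu> v) \<Longrightarrow> nX \<mu> u \<le> K1 * r"
    by (rule well_posed_stability[OF X[OF \<mu>] Y[OF \<mu>] dY wp]) blast
  obtain k where k: "\<And>u v. u \<in> X \<mu> \<Longrightarrow> v \<in> Y \<mu> \<Longrightarrow> \<bar>b \<mu> u v\<bar> \<le> k * nX \<mu> u * nY \<mu> v"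
    using wp unfolding well_posed_def continuous_bilinear_form_on_def by blast
  have bil: "bilinear_form_on (X \<mu>) (Y \<mu>) (b \<mu>)"
    using wp unfolding well_posed_def continuous_bilinear_form_on_def by blast
  have scaleY: "r * nY0 v \<le> r / c * nY \<mu> v" if "v \<in> Y0" "0 \<le> r" for v and r :: real
    using mult_left_mono[OF conjunct1[OF equivY[OF \<mu> that(1)]], of "r / c"] that pos by simp
  have "form_perturbation I X0 Z Y0 Z' nX0 nY0 (b \<mu>) bi (K1 / (c * c') + 1) (\<bar>k\<bar> * C' * C) M"
  proof
    show "1 \<le> K1 / (c * c') + 1" using K1(1) pos by simp
    show "nX0 u \<le> (K1 / (c * c') + 1) * r"
      if u: "u \<in> X0" and r: "0 \<le> r" and le: "\<And>v. v \<in> Y0 \<Longrightarrow> \<bar>b \<mu> u v\<bar> \<le> r * nY0 v" for u r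
    proof -
      have "nX \<mu> u \<le> K1 * (r / c)"
      proof (rule K1(2))
        show "\<bar>b \<mu> u v\<bar> \<le> r / c * nY \<mu> v" if "v \<in> Y0" for v
          using le[OF that] scaleY[OF that r] by linarith
      qed (use u sub r pos in auto)
      then have "c' * nX0 u \<le> K1 * (r / c)" using equivX[OF \<mu> u] by linarith
      then have "nX0 u \<le> K1 / (c * c') * r" using pos by (simp add: field_simps)
      then show ?thesis using r by (simp add: distrib_right)
    qed
    show "\<exists>u\<in>X0. \<forall>v\<in>Y0. \<bar>b \<mu> u v - g v\<bar> \<le> e * nY0 v" if g: "g \<in> dual_space Y0 nY0" and e: "0 < e" for g e
    proof -
      obtain r where r: "\<And>v. v \<in> Y0 \<Longrightarrow> \<bar>g v\<bar> \<le> r * nY0 v" and lin: "linear_form_on Y0 g"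
        using g unfolding dual_space_def by blast
      have bound: "\<bar>g v\<bar> \<le> \<bar>r\<bar> / c * nY \<mu> v" if v: "v \<in> Y0" for v
      proof -
        have "\<bar>g v\<bar> \<le> \<bar>r\<bar> * nY0 v"
          using r[OF v] mult_right_mono[OF abs_ge_self normed_space_on_nonneg[OF Y0 v], of r] by linarith
        then show ?thesis using scaleY[OF v, of "\<bar>r\<bar>"] by simp
      qed
      have r0: "0 \<le> \<bar>r\<bar> / c" and eC: "0 < e / C" using pos e by auto
      obtain w where w: "w \<in> X0" "\<And>v. v \<in> Y0 \<Longrightarrow> \<bar>b \<mu> w v - g v\<bar> \<le> e / C * nY \<mu> v"
        using well_posed_approximate_solution[OF X[OF \<mu>] Y[OF \<mu>] dX dY wp
            normed_space_on_subspace[OF Y0] lin r0 bound eC] by blast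
      have "\<bar>b \<mu> w v - g v\<bar> \<le> e * nY0 v" if v: "v \<in> Y0" for v
        using w(2)[OF v] mult_left_mono[OF conjunct2[OF equivY[OF \<mu> v]], of "e / C"] pos e by simp
      then show ?thesis using w(1) by blast
    qed
    show "bilinear_form_on X0 Y0 (b \<mu>)" using bilinear_form_on_subset[OF bil sub] .
    show "bilinear_form_on X0 Y0 (bi i)" if "i \<in> I" for i
      using bi[OF that] by (simp add: continuous_bilinear_form_on_def)
    show "0 \<le> \<bar>k\<bar> * C' * C" using pos by simp
    show "\<bar>b \<mu> u v\<bar> \<le> \<bar>k\<bar> * C' * C * nX0 u * nY0 v" if u: "u \<in> X0" and v: "v \<in> Y0" for u v
    proof -
      have uX: "u \<in> X \<mu>" and vY: "v \<in> Y \<mu>" using u v sub by auto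
      note nn = normed_space_on_nonneg[OF X[OF \<mu>] uX] normed_space_on_nonneg[OF Y[OF \<mu>] vY]
        normed_space_on_nonneg[OF X0 u]
      have "\<bar>b \<mu> u v\<bar> \<le> k * nX \<mu> u * nY \<mu> v" by (rule k[OF uX vY])
      also have "\<dots> \<le> \<bar>k\<bar> * (C' * nX0 u) * (C * nY0 v)"
        using equivX[OF \<mu> u] equivY[OF \<mu> v] nn pos by (intro mult_mono) auto
      finally show ?thesis by (simp add: mult_ac)
    qed
  qed (use I X0 Y0 M in auto)
  then show thesis by (rule that)
qed

text \<open>Near \<open>\<mu>0\<close> the form is the one at \<open>\<mu>0\<close> plus the
  \<open>bi i\<close> with the small weights \<open>\<theta>b i \<mu> - \<theta>b i \<mu>0\<close>,
  so constants at \<open>\<mu>0\<close> control the whole neighbourhood. Its radius \<open>d\<close>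
  does not depend on \<open>m\<close>, hence the same centres can serve every degree.\<close>

lemma local_approximation:
  assumes \<mu>0: "\<mu>0 \<in> P"
  obtains d A where "0 < d" "0 \<le> A"
    "\<And>m. \<exists>B\<subseteq>X0. finite B \<and> card B \<le> card J * m ^ card I \<and>
      (\<forall>\<mu>\<in>P. dist \<mu>0 \<mu> < d \<longrightarrow> (\<exists>w\<in>span B. nX \<mu> (\<sigma> \<mu> - w) \<le> A / 2 ^ m))"
proof -
  note X0S = normed_space_on_subspace[OF X0]
  obtain M where M: "0 \<le> M" "\<And>i. i \<in> I \<Longrightarrow> \<forall>u\<in>X0. \<forall>v\<in>Y0. \<bar>bi i u v\<bar> \<le> M * nX0 u * nY0 v"
  proof (rule finite_uniform_bound[OF I, of "\<lambda>i k. \<forall>u\<in>X0. \<forall>v\<in>Y0. \<bar>bi i u v\<bar> \<le> k * nX0 u * nY0 v"])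
    show "\<exists>k. \<forall>u\<in>X0. \<forall>v\<in>Y0. \<bar>bi i u v\<bar> \<le> k * nX0 u * nY0 v" if "i \<in> I" for i
      using bi[OF that] unfolding continuous_bilinear_form_on_def by blast
    show "\<forall>u\<in>X0. \<forall>v\<in>Y0. \<bar>bi i u v\<bar> \<le> l * nX0 u * nY0 v"
      if "\<forall>u\<in>X0. \<forall>v\<in>Y0. \<bar>bi i u v\<bar> \<le> k * nX0 u * nY0 v" "k \<le> l" for i k l
    proof (intro ballI)
      fix u v assume "u \<in> X0" "v \<in> Y0"
      then show "\<bar>bi i u v\<bar> \<le> l * nX0 u * nY0 v"
        using that normed_space_on_nonneg[OF X0] normed_space_on_nonneg[OF Y0]
        by (meson mult_right_mono order_trans)
    qed
  qed blast
  obtain K M0 where "form_perturbation I X0 Z Y0 Z' nX0 nY0 (b \<mu>0) bi K M0 M"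
    using form_perturbation_at[OF \<mu>0 M(1)] M(2) by metis
  then interpret form_perturbation I X0 Z Y0 Z' nX0 nY0 "b \<mu>0" bi K M0 M .
  \<comment> \<open>The largest value that \<open>taylor_approximation\<close> admits.\<close>
  define \<eta> where "\<eta> = 1 / (4 * (K * (card I * M + 1)))"
  have KM: "1 \<le> K * (card I * M + 1)" using K M(1) mult_mono[of 1 K 1 "card I * M + 1"] by simp
  have \<eta>: "0 < \<eta>" "\<eta> \<le> 1" "4 * (K * (card I * M + 1)) * \<eta> \<le> 1"
    using KM by (auto simp: \<eta>_def field_simps)
  obtain T where T: "0 \<le> T" "\<And>j. j \<in> J \<Longrightarrow> \<forall>\<mu>\<in>P. \<bar>\<theta>f j \<mu>\<bar> \<le> T"
  proof (rule finite_uniform_bound[OF J, of "\<lambda>j k. \<forall>\<mu>\<in>P. \<bar>\<theta>f j \<mu>\<bar> \<le> k"])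
    show "\<exists>k. \<forall>\<mu>\<in>P. \<bar>\<theta>f j \<mu>\<bar> \<le> k" if "j \<in> J" for j
      using compact_imp_bounded[OF compact_continuous_image[OF cont_f[OF that] P]]
      by (auto simp: bounded_iff)
  qed (blast intro: order_trans)+
  have "\<exists>d>0. \<forall>\<mu>\<in>P. dist \<mu>0 \<mu> < d \<longrightarrow> (\<forall>i\<in>I. \<bar>\<theta>b i \<mu> - \<theta>b i \<mu>0\<bar> \<le> \<eta>)"
  proof -
    have "\<forall>i\<in>I. eventually (\<lambda>\<mu>. dist (\<theta>b i \<mu>) (\<theta>b i \<mu>0) < \<eta>) (at \<mu>0 within P)"
      using cont_b \<mu>0 \<eta>(1) by (auto simp: continuous_on_def intro: tendstoD)
    then have "eventually (\<lambda>\<mu>. \<forall>i\<in>I. dist (\<theta>b i \<mu>) (\<theta>b i \<mu>0) < \<eta>) (at \<mu>0 within P)"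
      by (rule eventually_ball_finite[OF I])
    then obtain d where d: "0 < d"
      "\<And>\<mu> i. \<mu> \<in> P \<Longrightarrow> \<mu> \<noteq> \<mu>0 \<Longrightarrow> dist \<mu> \<mu>0 < d \<Longrightarrow> i \<in> I \<Longrightarrow> dist (\<theta>b i \<mu>) (\<theta>b i \<mu>0) < \<eta>"
      unfolding eventually_at by blast
    have "\<bar>\<theta>b i \<mu> - \<theta>b i \<mu>0\<bar> \<le> \<eta>" if "\<mu> \<in> P" "dist \<mu>0 \<mu> < d" "i \<in> I" for \<mu> i
      using d(2)[OF that(1) _ _ that(3)] that(2) \<eta>(1)
      by (cases "\<mu> = \<mu>0") (auto simp: dist_commute dist_real_def intro: less_imp_le)
    then show ?thesis using d(1) by blast
  qed
  then obtain d where d: "0 < d"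
    "\<And>\<mu> i. \<mu> \<in> P \<Longrightarrow> dist \<mu>0 \<mu> < d \<Longrightarrow> i \<in> I \<Longrightarrow> \<bar>\<theta>b i \<mu> - \<theta>b i \<mu>0\<bar> \<le> \<eta>"
    by blast
  have b_eq: "b \<mu> u v = b \<mu>0 u v + (\<Sum>i\<in>I. (\<theta>b i \<mu> - \<theta>b i \<mu>0) * bi i u v)"
    if "\<mu> \<in> P" "u \<in> X0" "v \<in> Y0" for \<mu> u v
    using that \<mu>0 by (simp add: b left_diff_distrib sum_subtractf)
  \<comment> \<open>The perturbation, of size at most \<open>card I * \<eta> * M\<close>, is
    absorbed: after multiplication by \<open>K\<close> its share is at most half of
    \<open>nX0 u\<close>. Moving it to the left doubles the constant.\<close>
  have stable_near: "nX0 u \<le> 2 * K * r"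
    if \<mu>: "\<mu> \<in> P" "dist \<mu>0 \<mu> < d" and u: "u \<in> X0" and r: "0 \<le> r"
      and le: "\<And>v. v \<in> Y0 \<Longrightarrow> \<bar>b \<mu> u v\<bar> \<le> r * nY0 v" for \<mu> u r
  proof -
    note nu = normed_space_on_nonneg[OF X0 u]
    have "nX0 u \<le> K * (r + card I * \<eta> * M * nX0 u)"
    proof (rule stable[OF u])
      show "0 \<le> r + card I * \<eta> * M * nX0 u" using r \<eta>(1) M(1) nu by simp
      fix v assume v: "v \<in> Y0"
      have "\<bar>\<Sum>i\<in>I. (\<theta>b i \<mu> - \<theta>b i \<mu>0) * bi i u v\<bar> \<le> (\<Sum>i\<in>I. \<eta> * (M * nX0 u * nY0 v))"
      proof (rule order_trans[OF sum_abs sum_mono])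
        fix i assume "i \<in> I"
        then show "\<bar>(\<theta>b i \<mu> - \<theta>b i \<mu>0) * bi i u v\<bar> \<le> \<eta> * (M * nX0 u * nY0 v)"
          unfolding abs_mult using d(2)[OF \<mu>] M(2) u v \<eta>(1) by (intro mult_mono) auto
      qed
      then have "\<bar>b \<mu>0 u v\<bar> \<le> r * nY0 v + card I * (\<eta> * (M * nX0 u * nY0 v))"
        using b_eq[OF \<mu>(1) u v] le[OF v] by simp
      then show "\<bar>b \<mu>0 u v\<bar> \<le> (r + card I * \<eta> * M * nX0 u) * nY0 v" by (simp add: algebra_simps)
    qed
    also have "\<dots> = K * r + (K * (card I * M) * \<eta>) * nX0 u" by (simp add: algebra_simps)
    also have "\<dots> \<le> K * r + 1 / 2 * nX0 u"
    proof -
      have "K * (card I * M) * \<eta> \<le> K * (card I * M + 1) * \<eta>"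
        using K \<eta>(1) by (intro mult_right_mono mult_left_mono) auto
      then have "K * (card I * M) * \<eta> \<le> 1 / 2" using \<eta>(3) by linarith
      then show ?thesis using nu by (intro add_left_mono mult_right_mono)
    qed
    finally show ?thesis by simp
  qed
  define good where "good j A m B \<longleftrightarrow> B \<subseteq> X0 \<and> finite B \<and> card B \<le> m ^ card I \<and>
      (\<forall>\<delta>. (\<forall>i\<in>I. \<bar>\<delta> i\<bar> \<le> \<eta>) \<longrightarrow> (\<exists>w\<in>span B. \<forall>v\<in>Y0.
        \<bar>fi j v - (b \<mu>0 w v + (\<Sum>i\<in>I. \<delta> i * bi i w v))\<bar> \<le> A / 2 ^ m * nY0 v))"
    for j m B and A :: real
  have "\<exists>A\<ge>0. \<forall>m. \<exists>B. good j A m B" if j: "j \<in> J" for j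
  proof -
    obtain G where G: "\<forall>v\<in>Y0. \<bar>fi j v\<bar> \<le> G * nY0 v" and lin: "linear_form_on Y0 (fi j)"
      using fi[OF j] unfolding dual_space_def by blast
    have bound: "\<forall>v\<in>Y0. \<bar>fi j v\<bar> \<le> \<bar>G\<bar> * nY0 v"
      using G mult_right_mono[OF abs_ge_self[of G] normed_space_on_nonneg[OF Y0]] order_trans by blast
    show ?thesis
    proof (rule taylor_approximation[OF lin abs_ge_zero bound less_imp_le[OF \<eta>(1)] \<eta>(2,3)], goal_cases)
      case (1 A)
      show ?case by (unfold good_def, rule exI[of _ A], rule conjI[OF 1(1)], rule allI, rule 1(2))
    qed
  qed
  then obtain A where A: "\<And>j. j \<in> J \<Longrightarrow> 0 \<le> A j" "\<And>j m. j \<in> J \<Longrightarrow> \<exists>B. good j (A j) m B"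
    by metis
  \<comment> \<open>\<open>T\<close> and the sum over \<open>J\<close> bound the residual,
    \<open>2 * K\<close> is the stability constant near the centre, and \<open>C'\<close> passes to
    the norm at \<mu>.\<close>
  define A' where "A' = C' * (2 * K) * (T * (\<Sum>j\<in>J. A j))"
  have "\<exists>B\<subseteq>X0. finite B \<and> card B \<le> card J * m ^ card I \<and>
      (\<forall>\<mu>\<in>P. dist \<mu>0 \<mu> < d \<longrightarrow> (\<exists>w\<in>span B. nX \<mu> (\<sigma> \<mu> - w) \<le> A' / 2 ^ m))" for m
  proof -
    obtain B where "\<And>j. j \<in> J \<Longrightarrow> good j (A j) m (B j)"
      using A(2)[of _ m] by metis
    then have B: "\<And>j. j \<in> J \<Longrightarrow> B j \<subseteq> X0" "\<And>j. j \<in> J \<Longrightarrow> finite (B j)"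
      "\<And>j. j \<in> J \<Longrightarrow> card (B j) \<le> m ^ card I"
      "\<And>j \<delta>. j \<in> J \<Longrightarrow> (\<forall>i\<in>I. \<bar>\<delta> i\<bar> \<le> \<eta>) \<Longrightarrow> \<exists>w\<in>span (B j). \<forall>v\<in>Y0.
        \<bar>fi j v - (b \<mu>0 w v + (\<Sum>i\<in>I. \<delta> i * bi i w v))\<bar> \<le> A j / 2 ^ m * nY0 v"
      unfolding good_def by blast+
    define BB where "BB = (\<Union>j\<in>J. B j)"
    have BBX: "BB \<subseteq> X0" "finite BB" using B(1,2) J by (auto simp: BB_def)
    have "card BB \<le> (\<Sum>j\<in>J. card (B j))" unfolding BB_def by (rule card_UN_le[OF J])
    also have "\<dots> \<le> card J * m ^ card I" using sum_bounded_above[of J "\<lambda>j. card (B j)" "m ^ card I"] B(3) by simp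
    finally have cardBB: "card BB \<le> card J * m ^ card I" .
    have spanX: "span BB \<subseteq> X0" using BBX(1) X0S by (rule span_minimal)
    have "\<exists>w\<in>span BB. nX \<mu> (\<sigma> \<mu> - w) \<le> A' / 2 ^ m" if \<mu>: "\<mu> \<in> P" "dist \<mu>0 \<mu> < d" for \<mu>
    proof -
      have "\<exists>w\<in>span (B j). \<forall>v\<in>Y0. \<bar>fi j v - b \<mu> w v\<bar> \<le> A j / 2 ^ m * nY0 v" if j: "j \<in> J" for j
      proof -
        obtain w where w: "w \<in> span (B j)" "\<And>v. v \<in> Y0 \<Longrightarrow>
            \<bar>fi j v - (b \<mu>0 w v + (\<Sum>i\<in>I. (\<theta>b i \<mu> - \<theta>b i \<mu>0) * bi i w v))\<bar> \<le> A j / 2 ^ m * nY0 v"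
          using B(4)[OF j, of "\<lambda>i. \<theta>b i \<mu> - \<theta>b i \<mu>0"] d(2)[OF \<mu>] by blast
        have wX0: "w \<in> X0" using w(1) span_minimal[OF B(1)[OF j] X0S] by blast
        have "\<bar>fi j v - b \<mu> w v\<bar> \<le> A j / 2 ^ m * nY0 v" if v: "v \<in> Y0" for v
          unfolding b_eq[OF \<mu>(1) wX0 v] by (rule w(2)[OF v])
        then show ?thesis using w(1) by blast
      qed
      then obtain w where w: "\<And>j. j \<in> J \<Longrightarrow> w j \<in> span (B j)"
        "\<And>j v. j \<in> J \<Longrightarrow> v \<in> Y0 \<Longrightarrow> \<bar>fi j v - b \<mu> (w j) v\<bar> \<le> A j / 2 ^ m * nY0 v"
        by metis
      have wBB: "w j \<in> span BB" if "j \<in> J" for j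
        using w(1)[OF that] span_mono[of "B j" BB] that by (auto simp: BB_def)
      \<comment> \<open>The solution depends linearly on the right-hand side, so the approximants
        for the single \<open>fi j\<close> are superposed with the weights of f_\<mu>. Each
        \<open>w j\<close> depends on \<mu>, but the span of \<open>BB\<close> does not.\<close>
      define x where "x = (\<Sum>j\<in>J. \<theta>f j \<mu> *\<^sub>R w j)"
      have x: "x \<in> span BB" unfolding x_def using wBB by (intro span_sum span_scale)
      have sub: "X0 \<subseteq> X \<mu>" "Y0 \<subseteq> Y \<mu>" using denseX[OF \<mu>(1)] denseY[OF \<mu>(1)] by (auto simp: dense_in_norm_def)
      have bil: "bilinear_form_on X0 Y0 (b \<mu>)"
        using well_posed[OF \<mu>(1)] bilinear_form_on_subset[OF _ sub]
        unfolding well_posed_def continuous_bilinear_form_on_def by blast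
      have "nX \<mu> (\<sigma> \<mu> - x) \<le> C' * (2 * K) * (T * (\<Sum>j\<in>J. A j) / 2 ^ m)"
      proof (rule well_posed_error_bound[OF X[OF \<mu>(1)] Y[OF \<mu>(1)] denseX[OF \<mu>(1)] denseY[OF \<mu>(1)]
            well_posed[OF \<mu>(1)] X0S, where u = "\<sigma> \<mu>"])
        show "nX \<mu> u \<le> C' * nX0 u" if "u \<in> X0" for u using equivX[OF \<mu>(1) that] by simp
        show "nY \<mu> v \<le> C * nY0 v" if "v \<in> Y0" for v using equivY[OF \<mu>(1) that] by simp
        show "0 \<le> C'" "0 \<le> C" "0 \<le> 2 * K" using pos K by auto
        show "0 \<le> T * (\<Sum>j\<in>J. A j) / 2 ^ m" using T(1) A(1) by (simp add: sum_nonneg)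
        show "nX0 u \<le> 2 * K * r" if "u \<in> X0" "0 \<le> r" "\<And>v. v \<in> Y0 \<Longrightarrow> \<bar>b \<mu> u v\<bar> \<le> r * nY0 v" for u r
          using stable_near[OF \<mu> that] .
        show "solves (X \<mu>) (Y \<mu>) (b \<mu>) (f \<mu>) (\<sigma> \<mu>)" by (rule solution[OF \<mu>(1)])
        show "x \<in> X0" using x spanX by blast
        fix v assume v: "v \<in> Y0"
        have "b \<mu> x v = (\<Sum>j\<in>J. \<theta>f j \<mu> * b \<mu> (w j) v)"
          unfolding x_def using wBB spanX
          by (intro linear_form_on_sum[OF bilinear_form_on_left[OF bil v] X0S J]) auto
        then have "f \<mu> v - b \<mu> x v = (\<Sum>j\<in>J. \<theta>f j \<mu> * (fi j v - b \<mu> (w j) v))"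
          by (simp add: f[OF \<mu>(1) v] right_diff_distrib sum_subtractf)
        also have "\<bar>\<dots>\<bar> \<le> (\<Sum>j\<in>J. T * (A j / 2 ^ m * nY0 v))"
        proof (rule order_trans[OF sum_abs sum_mono])
          fix j assume j: "j \<in> J"
          show "\<bar>\<theta>f j \<mu> * (fi j v - b \<mu> (w j) v)\<bar> \<le> T * (A j / 2 ^ m * nY0 v)"
            unfolding abs_mult using T(1) T(2)[OF j] \<mu>(1) w(2)[OF j v] by (intro mult_mono) auto
        qed
        also have "\<dots> = T * (\<Sum>j\<in>J. A j) / 2 ^ m * nY0 v"
          by (simp add: sum_distrib_left sum_distrib_right sum_divide_distrib mult.assoc)
        finally show "\<bar>f \<mu> v - b \<mu> x v\<bar> \<le> T * (\<Sum>j\<in>J. A j) / 2 ^ m * nY0 v" .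
      qed
      then show ?thesis using x by (auto simp: A'_def)
    qed
    then show ?thesis using BBX cardBB by blast
  qed
  moreover have "0 \<le> A'" unfolding A'_def using pos K T(1) A(1) by (simp add: sum_nonneg)
  ultimately show thesis using d(1) that by blast
qed

text \<open>Each \<mu> is served by a ball of a finite subcover that contains it. Joining the
  spanning sets of all centres only enlarges the span, and multiplies the dimension by a
  constant.\<close>

lemma uniform_approximation:
  obtains k A where "0 < k" "0 \<le> A"
    "\<And>m. \<exists>B\<subseteq>X0. finite B \<and> card B \<le> k * m ^ card I \<and>
      (\<forall>\<mu>\<in>P. \<exists>w\<in>span B. nX \<mu> (\<sigma> \<mu> - w) \<le> A / 2 ^ m)"
proof -
  have "\<forall>\<nu>\<in>P. \<exists>d A. 0 < d \<and> 0 \<le> A \<and> (\<forall>m. \<exists>B\<subseteq>X0. finite B \<and> card B \<le> card J * m ^ card I \<and>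
      (\<forall>\<mu>\<in>P. dist \<nu> \<mu> < d \<longrightarrow> (\<exists>w\<in>span B. nX \<mu> (\<sigma> \<mu> - w) \<le> A / 2 ^ m)))"
  proof
    fix \<nu> assume \<nu>: "\<nu> \<in> P"
    show "\<exists>d A. 0 < d \<and> 0 \<le> A \<and> (\<forall>m. \<exists>B\<subseteq>X0. finite B \<and> card B \<le> card J * m ^ card I \<and>
      (\<forall>\<mu>\<in>P. dist \<nu> \<mu> < d \<longrightarrow> (\<exists>w\<in>span B. nX \<mu> (\<sigma> \<mu> - w) \<le> A / 2 ^ m)))"
    proof (rule local_approximation[OF \<nu>], goal_cases)
      case (1 d A)
      show ?case by (rule exI[of _ d], rule exI[of _ A], intro conjI allI) (fact 1)+
    qed
  qed
  then obtain d A where d: "\<And>\<nu>. \<nu> \<in> P \<Longrightarrow> 0 < d \<nu>" and A: "\<And>\<nu>. \<nu> \<in> P \<Longrightarrow> 0 \<le> A \<nu>"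
    and dA: "\<And>\<nu> m. \<nu> \<in> P \<Longrightarrow> \<exists>B\<subseteq>X0. finite B \<and> card B \<le> card J * m ^ card I \<and>
      (\<forall>\<mu>\<in>P. dist \<nu> \<mu> < d \<nu> \<longrightarrow> (\<exists>w\<in>span B. nX \<mu> (\<sigma> \<mu> - w) \<le> A \<nu> / 2 ^ m))"
    by metis
  obtain T where T: "T \<subseteq> P" "finite T" "P \<subseteq> (\<Union>\<nu>\<in>T. ball \<nu> (d \<nu>))"
    by (rule compactE_image[OF P, of P "\<lambda>\<nu>. ball \<nu> (d \<nu>)"]) (use d in auto)
  show thesis
  proof
    \<comment> \<open>The summand 1 keeps the factor positive when \<open>T\<close> or
      \<open>J\<close> is empty; \<open>width_rate\<close> divides by it.\<close>
    show "0 < card T * card J + 1" by simp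
    show "0 \<le> (\<Sum>\<nu>\<in>T. A \<nu>)" using A T(1) by (auto intro: sum_nonneg)
    fix m
    obtain B where B: "\<And>\<nu>. \<nu> \<in> T \<Longrightarrow> B \<nu> \<subseteq> X0" "\<And>\<nu>. \<nu> \<in> T \<Longrightarrow> finite (B \<nu>)"
      "\<And>\<nu>. \<nu> \<in> T \<Longrightarrow> card (B \<nu>) \<le> card J * m ^ card I"
      "\<And>\<nu> \<mu>. \<nu> \<in> T \<Longrightarrow> \<mu> \<in> P \<Longrightarrow> dist \<nu> \<mu> < d \<nu> \<Longrightarrow> \<exists>w\<in>span (B \<nu>). nX \<mu> (\<sigma> \<mu> - w) \<le> A \<nu> / 2 ^ m"
      using dA[OF subsetD[OF T(1)], of _ m] by metis
    have "card (\<Union>\<nu>\<in>T. B \<nu>) \<le> (\<Sum>\<nu>\<in>T. card (B \<nu>))" by (rule card_UN_le[OF T(2)])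
    also have "\<dots> \<le> card T * (card J * m ^ card I)" using sum_bounded_above[of T "\<lambda>\<nu>. card (B \<nu>)" "card J * m ^ card I"] B(3) by simp
    also have "\<dots> \<le> (card T * card J + 1) * m ^ card I" by (simp add: algebra_simps)
    finally have "card (\<Union>\<nu>\<in>T. B \<nu>) \<le> (card T * card J + 1) * m ^ card I" .
    moreover have "\<exists>w\<in>span (\<Union>\<nu>\<in>T. B \<nu>). nX \<mu> (\<sigma> \<mu> - w) \<le> (\<Sum>\<nu>\<in>T. A \<nu>) / 2 ^ m" if \<mu>: "\<mu> \<in> P" for \<mu>
    proof -
      obtain \<nu> where \<nu>: "\<nu> \<in> T" "dist \<nu> \<mu> < d \<nu>" using T(3) \<mu> by auto
      obtain w where w: "w \<in> span (B \<nu>)" "nX \<mu> (\<sigma> \<mu> - w) \<le> A \<nu> / 2 ^ m" using B(4)[OF \<nu>(1) \<mu> \<nu>(2)] by blast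
      have "A \<nu> \<le> (\<Sum>\<nu>\<in>T. A \<nu>)" using A T(1,2) \<nu>(1) by (intro member_le_sum) auto
      then have "A \<nu> / 2 ^ m \<le> (\<Sum>\<nu>\<in>T. A \<nu>) / 2 ^ m" by (simp add: divide_right_mono)
      moreover have "w \<in> span (\<Union>\<nu>\<in>T. B \<nu>)" using w(1) span_mono[of "B \<nu>" "\<Union>\<nu>\<in>T. B \<nu>"] \<nu>(1) by auto
      ultimately show ?thesis using w(2) by (meson order_trans)
    qed
    ultimately show "\<exists>B\<subseteq>X0. finite B \<and> card B \<le> (card T * card J + 1) * m ^ card I \<and>
      (\<forall>\<mu>\<in>P. \<exists>w\<in>span B. nX \<mu> (\<sigma> \<mu> - w) \<le> (\<Sum>\<nu>\<in>T. A \<nu>) / 2 ^ m)"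
      using B(1,2) T(2) by (intro exI[of _ "\<Union>\<nu>\<in>T. B \<nu>"]) auto
  qed
qed

end

section \<open>From approximation to the width\<close>

text \<open>Constant sections are a linear copy of \<open>X0\<close>. The embedding carries
  \<open>span B\<close> to a space of sections spanned by at most \<open>N\<close> elements, and at
  each \<mu> the distance to that space is the distance to \<open>span B\<close>.\<close>

lemma sectional_width_le:
  fixes X0 :: "'v::real_vector set"
  assumes X0: "subspace X0" and B: "B \<subseteq> X0" "finite B" "card B \<le> N"
    and approx: "\<And>\<mu>. \<mu> \<in> P \<Longrightarrow> \<exists>w\<in>span B. nX \<mu> (\<sigma> \<mu> - w) \<le> e"
  shows "sectional_width P nX (const_sections X0) N \<sigma> \<le> ennreal e"
proof -
  define K :: "'v \<Rightarrow> 'a \<Rightarrow> 'v" where "K \<phi> = (\<lambda>\<mu>. \<phi>)" for \<phi>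
  have "linear K" by (rule linearI) (auto simp: K_def fun_eq_iff scaleR_fun_def)
  then have S: "span (K ` B) = K ` span B" by (rule linear_span_image)
  have "dim_at_most (span (K ` B)) N"
    unfolding dim_at_most_def using B(2,3) card_image_le[OF B(2), of K] by (intro exI[of _ "K ` B"]) auto
  moreover have "K ` span B \<subseteq> const_sections X0"
    using span_minimal[OF B(1) X0] by (auto simp: K_def const_sections_def)
  ultimately have "K ` span B \<in> {S. S \<subseteq> const_sections X0 \<and> subspace S \<and> dim_at_most S N}"
    by (auto simp flip: S)
  moreover have "(SUP \<mu>\<in>P. INF \<tau>\<in>K ` span B. ennreal (nX \<mu> (\<sigma> \<mu> - \<tau> \<mu>))) \<le> ennreal e"
  proof (rule SUP_least)
    fix \<mu> assume "\<mu> \<in> P"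
    then obtain w where w: "w \<in> span B" "nX \<mu> (\<sigma> \<mu> - w) \<le> e" using approx by blast
    then show "(INF \<tau>\<in>K ` span B. ennreal (nX \<mu> (\<sigma> \<mu> - \<tau> \<mu>))) \<le> ennreal e"
      by (intro INF_lower2[of "K w"]) (auto simp: K_def intro: ennreal_leI)
  qed
  ultimately show ?thesis unfolding sectional_width_def by (rule INF_lower2)
qed

text \<open>\<open>m\<close> is the largest degree for which \<open>k * m ^ Q\<close> coefficients
  fit into dimension \<open>N\<close>, the integer part of (N/k)^(1/Q). Rounding down loses less
  than one degree, hence the factor 2. For \<open>N < k\<close> this gives degree 0, and the
  estimate still holds.\<close>

lemma width_rate:
  fixes N Q k :: nat
  assumes "1 \<le> Q" "0 < k"
  obtains m where "k * m ^ Q \<le> N"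
    "1 / 2 ^ m \<le> 2 * exp (- (ln 2 * real k powr (- 1 / real Q)) * real N powr (1 / real Q))"
proof
  define x where "x = (real N / real k) powr (1 / real Q)"
  have x: "0 \<le> x" by (simp add: x_def)
  define m where "m = nat \<lfloor>x\<rfloor>"
  have m: "real m \<le> x" "x < real m + 1" using x by (auto simp: m_def)
  have "real m ^ Q \<le> x ^ Q" using m(1) by (intro power_mono) auto
  also have "x ^ Q = x powr real Q" using x assms(1) by (simp add: powr_realpow')
  also have "\<dots> = real N / real k" using assms by (simp add: x_def powr_powr)
  finally have "real (k * m ^ Q) \<le> real N" using assms(2) by (simp add: field_simps)
  then show "k * m ^ Q \<le> N" by (simp only: of_nat_le_iff)
  have x_eq: "x = real k powr (- 1 / real Q) * real N powr (1 / real Q)"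
    by (simp add: x_def powr_divide powr_minus field_simps)
  have "exp (ln 2 * (real m + 1)) = 2 * 2 ^ m"
    using exp_of_nat_mult[of "Suc m" "ln 2 :: real"] by (simp add: algebra_simps)
  then have "1 / 2 ^ m = 2 * exp (- (ln 2 * (real m + 1)))"
    unfolding exp_minus by (simp add: inverse_eq_divide)
  also have "\<dots> \<le> 2 * exp (- (ln 2 * x))" using m(2) by simp
  finally show "1 / 2 ^ m \<le> 2 * exp (- (ln 2 * real k powr (- 1 / real Q)) * real N powr (1 / real Q))"
    by (simp add: x_eq mult_ac)
qed

theorem theorem3:
  fixes P :: "(real ^ 'p) set"
    and \<Omega> :: "(real ^ 'd) set"
    and M :: "(real ^ 'd) measure"
    and X Y :: "real ^ 'p \<Rightarrow> (real ^ 'd \<Rightarrow> real ^ 'm) set"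
    and nX nY :: "real ^ 'p \<Rightarrow> (real ^ 'd \<Rightarrow> real ^ 'm) \<Rightarrow> real"
    and b :: "real ^ 'p \<Rightarrow> (real ^ 'd \<Rightarrow> real ^ 'm) \<Rightarrow> (real ^ 'd \<Rightarrow> real ^ 'm) \<Rightarrow> real"
    and f :: "real ^ 'p \<Rightarrow> (real ^ 'd \<Rightarrow> real ^ 'm) \<Rightarrow> real"
    and \<sigma>sol :: "real ^ 'p \<Rightarrow> (real ^ 'd \<Rightarrow> real ^ 'm)"
    and X0 Y0 :: "(real ^ 'd \<Rightarrow> real ^ 'm) set"
    and nX0 nY0 :: "(real ^ 'd \<Rightarrow> real ^ 'm) \<Rightarrow> real"
    and c c' C C' :: real
    and Qb Qf :: nat
    and \<theta>b \<theta>f :: "nat \<Rightarrow> real ^ 'p \<Rightarrow> real"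
    and bi :: "nat \<Rightarrow> (real ^ 'd \<Rightarrow> real ^ 'm) \<Rightarrow> (real ^ 'd \<Rightarrow> real ^ 'm) \<Rightarrow> real"
    and fi :: "nat \<Rightarrow> (real ^ 'd \<Rightarrow> real ^ 'm) \<Rightarrow> real"
  assumes "compact P"
    and "open \<Omega>" and "connected \<Omega>" and "\<Omega> \<noteq> {}" and "bounded \<Omega>"
    and "M = count_space \<Omega> \<or> M = lebesgue_on \<Omega>"
    and "\<And>\<mu>. \<mu> \<in> P \<Longrightarrow> banach_space_on (null_funs M) (X \<mu>) (nX \<mu>)"
    and "\<And>\<mu>. \<mu> \<in> P \<Longrightarrow> banach_space_on (null_funs M) (Y \<mu>) (nY \<mu>)"
    and "\<And>\<mu>. \<mu> \<in> P \<Longrightarrow>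
           well_posed (null_funs M) (X \<mu>) (nX \<mu>) (Y \<mu>) (nY \<mu>) (b \<mu>) (f \<mu>)"
    and "\<And>\<mu>. \<mu> \<in> P \<Longrightarrow> solves (X \<mu>) (Y \<mu>) (b \<mu>) (f \<mu>) (\<sigma>sol \<mu>)"
    and "X0 = (\<Inter>\<mu>\<in>P. X \<mu>)" and "Y0 = (\<Inter>\<mu>\<in>P. Y \<mu>)"
    and "\<And>\<mu>. \<mu> \<in> P \<Longrightarrow> dense_in_norm X0 (X \<mu>) (nX \<mu>)"
    and "\<And>\<mu>. \<mu> \<in> P \<Longrightarrow> dense_in_norm Y0 (Y \<mu>) (nY \<mu>)"
    and "normed_space_on (null_funs M) X0 nX0" and "normed_space_on (null_funs M) Y0 nY0"
    and "c > 0" and "c' > 0" and "C > 0" and "C' > 0"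
    and "\<And>\<mu> u. \<mu> \<in> P \<Longrightarrow> u \<in> X0 \<Longrightarrow> c' * nX0 u \<le> nX \<mu> u \<and> nX \<mu> u \<le> C' * nX0 u"
    and "\<And>\<mu> v. \<mu> \<in> P \<Longrightarrow> v \<in> Y0 \<Longrightarrow> c * nY0 v \<le> nY \<mu> v \<and> nY \<mu> v \<le> C * nY0 v"
    and "Qb \<ge> 1"
    and "\<And>i. i \<in> {1..Qb} \<Longrightarrow> continuous_on P (\<theta>b i)"
    and "\<And>i. i \<in> {1..Qf} \<Longrightarrow> continuous_on P (\<theta>f i)"
    and "\<And>i. i \<in> {1..Qb} \<Longrightarrow> continuous_bilinear_form_on X0 nX0 Y0 nY0 (bi i)"
    and "\<And>i. i \<in> {1..Qf} \<Longrightarrow> fi i \<in> dual_space Y0 nY0"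
    and "\<And>\<mu> u v. \<mu> \<in> P \<Longrightarrow> u \<in> X0 \<Longrightarrow> v \<in> Y0 \<Longrightarrow> b \<mu> u v = (\<Sum>i=1..Qb. \<theta>b i \<mu> * bi i u v)"
    and "\<And>\<mu> v. \<mu> \<in> P \<Longrightarrow> v \<in> Y0 \<Longrightarrow> f \<mu> v = (\<Sum>i=1..Qf. \<theta>f i \<mu> * fi i v)"
  shows "\<exists>\<alpha>>0. \<exists>\<beta>>0. \<forall>N\<ge>1.
           sectional_width P nX (const_sections X0) N \<sigma>sol
             \<le> ennreal (\<alpha> * exp (- \<beta> * real N powr (1 / real Qb)))"
proof -
  have "separable_problem P (null_funs M) X0 (null_funs M) Y0 X nX Y nY nX0 nY0 b f \<sigma>sol c c' C C'
      {1..Qb} {1..Qf} \<theta>b \<theta>f bi fi"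
    by unfold_locales (use assms in \<open>auto simp: banach_space_on_def\<close>)
  then interpret separable_problem P "null_funs M" X0 "null_funs M" Y0 X nX Y nY nX0 nY0 b f \<sigma>sol c c' C C'
    "{1..Qb}" "{1..Qf}" \<theta>b \<theta>f bi fi .
  obtain k A where k: "0 < k" and A: "0 \<le> A"
    and approx: "\<And>m. \<exists>B\<subseteq>X0. finite B \<and> card B \<le> k * m ^ card {1..Qb} \<and>
      (\<forall>\<mu>\<in>P. \<exists>w\<in>span B. nX \<mu> (\<sigma>sol \<mu> - w) \<le> A / 2 ^ m)"
    using uniform_approximation by metis
  \<comment> \<open>The factor 2 is that of \<open>width_rate\<close>; 1 is added to make \<alpha>
    positive even if \<open>A\<close> is 0.\<close>
  define \<alpha> where "\<alpha> = 2 * A + 1"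
  define \<beta> where "\<beta> = ln 2 * real k powr (- 1 / real Qb)"
  have "sectional_width P nX (const_sections X0) N \<sigma>sol
      \<le> ennreal (\<alpha> * exp (- \<beta> * real N powr (1 / real Qb)))" for N
  proof -
    obtain m where m: "k * m ^ Qb \<le> N" "1 / 2 ^ m \<le> 2 * exp (- \<beta> * real N powr (1 / real Qb))"
      using width_rate[OF \<open>Qb \<ge> 1\<close> k] unfolding \<beta>_def by metis
    obtain B where B: "B \<subseteq> X0" "finite B" "card B \<le> N"
      "\<And>\<mu>. \<mu> \<in> P \<Longrightarrow> \<exists>w\<in>span B. nX \<mu> (\<sigma>sol \<mu> - w) \<le> A / 2 ^ m"
      using approx[of m] m(1) by (auto intro: order_trans)
    have "sectional_width P nX (const_sections X0) N \<sigma>sol \<le> ennreal (A / 2 ^ m)"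
      using B(4) by (rule sectional_width_le[OF normed_space_on_subspace[OF X0] B(1-3)])
    also have "A / 2 ^ m \<le> \<alpha> * exp (- \<beta> * real N powr (1 / real Qb))"
      using mult_left_mono[OF m(2) A] by (simp add: \<alpha>_def algebra_simps add_increasing)
    finally show ?thesis by (simp add: ennreal_leI)
  qed
  moreover have "0 < \<alpha>" "0 < \<beta>" using A k by (auto simp: \<alpha>_def \<beta>_def)
  ultimately show ?thesis by blast
qed

end
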